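(* Consider the boundary system $C(\tilde s)\Sigma=h^{p+2}\hat T_C$ at $\tilde s=i\tilde\xi+\eta h$, where $\tilde\xi\in\mathbb{R}$ and $\eta>0$ is a constant independent of $h$. Let $\delta$ be a small but $h$-independent positive constant. (1) When $\tilde s$ is in the vicinity of the origin, i.e. $|\tilde s|\le\delta$, there exists a non-negative integer $w$ such that $$|\Sigma_i|\leq h^{p+2-w}\frac{K}{\eta^w}\|\hat T_C\|_{\max}$$ for every component $\Sigma_i$ of $\Sigma$. If $C(0)$ is nonsingular, then $w=0$. Otherwise, $w$ can be determined by the precise form of the boundary system. (2) When $\tilde s$ is away from the origin, i.e. $|\tilde s|>\delta$, there exists a non-negative integer $\alpha$ such that $$|\Sigma_i|\leq h^{p+2}\frac{K}{(\eta\delta)^\alpha}\left\|\widehat{\frac{\partial^\alpha T_C}{\partial t^\alpha}}\right\|_{\max}$$ for every component $\Sigma_i$ of $\Sigma$. The value of $\alpha$ can be determined by the precise form of the boundary system. Here $K$ denotes a constant independent of $h$.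
   Context: Setting. The half-line wave equation $U_{tt}=U_{xx}$, $0\le x<\infty$, $t\ge0$, with initial and boundary conditions making it well-posed and with smooth $L_2$ solution $U$, is discretized on the grid $x_i=(i-1)h$, $i=1,2,\dots$, by $u_{tt}=\frac{Q}{h^2}u$. Here $Q/h^2$ approximates the second derivative including the boundary condition; away from the boundary $x=0$ the rows of $Q/h^2$ are the standard central finite difference stencil of order $2l$, and finitely many rows (a number independent of $h$) near the boundary are modified. $Q$ does not depend on $h$. The semi-discretization is assumed (energy) stable. Initial and boundary data are compatible: spatial derivatives of initial data on the boundary and temporal derivatives of the boundary data at $t=0$ vanish to sufficiently high order. Error equation. In Laplace space ($s$ dual to $t$, $\tilde s=sh$, $\hat{\ }$ the Laplace transform) the error $\hat\zeta$ caused by the boundary truncation error $h^pT$ satisfies $\tilde s^2\hat\zeta=Q\hat\zeta+h^{p+2}\hat T$. Only the components $\hat T_0,\dots,\hat T_k$ near the boundary are nonzero ($k$ independent of $h$), and to leading order $\hat T_i=a_i\frac{\partial^{p+2}}{\partial x^{p+2}}\hat U(0,s)$ with constants $a_i$ independent of $h$. Boundary system. Inserting $\hat\zeta_n=\kappa^n$ into the interior equations gives the characteristic equation; its admissible roots $\kappa_1(\tilde s),\dots,\kappa_l(\tilde s)$ are those with $|\kappa(\tilde s)|<1$ for all $\mathrm{Re}(\tilde s)>0$. The general solution of the error equation in $L_2$ has the form $$\hat\zeta=\Big[\hat\zeta_1,\dots,\hat\zeta_d,\ \sum_{j=1}^l\sigma_j,\ \sum_{j=1}^l\sigma_j\kappa_j,\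 \sum_{j=1}^l\sigma_j\kappa_j^2,\cdots\Big]^T,$$ where $d$ depends on the numerical boundary treatment. Inserting this into the first rows of the error equation (those not satisfied automatically) gives the boundary system $C(\tilde s)\Sigma=h^{p+2}\hat T_C$ for the unknowns $\Sigma=[\hat\zeta_1,\dots,\hat\zeta_d,\sigma_1,\dots,\sigma_l]^T$, where $C(\tilde s)$ is a square matrix of size independent of $h$ (the determinant matrix), and $\hat T_C$ consists of $\hat T_0,\dots,\hat T_k$, padded with zeros if needed. $C(\tilde s)$ on the imaginary axis, in particular $C(0)$, is understood by continuity from $\mathrm{Re}(\tilde s)>0$. $\|v\|_{\max}=\max_i|v_i|$ for vectors. *)

theory Defs
  imports "HOL-Analysis.Analysis" "Jordan_Normal_Form.Determinant"
begin

text \<open>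
  Grid functions are sequences indexed from 0. The infinite matrix \<open>Q\<close> is the undivided operator
  (the scheme is \<open>u_tt = Q u / h^2\<close>), so it does not depend on \<open>h\<close>. Its rows are finitely supported
  wherever \<open>apply_op\<close> is used.
\<close>

definition apply_op :: "(nat \<Rightarrow> nat \<Rightarrow> real) \<Rightarrow> (nat \<Rightarrow> 'a::real_vector) \<Rightarrow> nat \<Rightarrow> 'a" where
  "apply_op Q u n = (\<Sum>m | Q n m \<noteq> 0. Q n m *\<^sub>R u m)"

text \<open>
  Coefficient at offset \<open>m\<close> of the central difference stencil of width \<open>2l+1\<close> and order \<open>2l\<close> for
  \<open>h^2 d^2/dx^2\<close>; for \<open>l = 1\<close> it is \<open>(1, -2, 1)\<close>, for \<open>l = 2\<close> it is
  \<open>(-1/12, 4/3, -5/2, 4/3, -1/12)\<close>.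
\<close>

definition central_stencil :: "nat \<Rightarrow> int \<Rightarrow> real" where
  "central_stencil l m =
     (if m = 0 then - 2 * (\<Sum>i = 1..l. 1 / (real i)\<^sup>2)
      else if \<bar>m\<bar> \<le> int l then
        2 * (-1) ^ (nat \<bar>m\<bar> + 1) * (fact l)\<^sup>2
          / ((of_int m)\<^sup>2 * fact (nat (int l - m)) * fact (nat (int l + m)))
      else 0)"

text \<open>
  Only the first \<open>d + l\<close> rows may differ from the central stencil. With the ansatz below, which
  is a combination of powers \<open>\<kappa>^m\<close> from component \<open>d\<close> on, the rows from \<open>d + l\<close> on are
  satisfied automatically, and the first \<open>d + l\<close> rows form the boundary system.
\<close>

definition half_line_scheme :: "nat \<Rightarrow> nat \<Rightarrow> (nat \<Rightarrow> nat \<Rightarrow> real) \<Rightarrow> bool" where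
  "half_line_scheme l d Q \<longleftrightarrow>
     (\<forall>n < d + l. finite {m. Q n m \<noteq> 0}) \<and>
     (\<forall>n \<ge> d + l. \<forall>m. Q n m = central_stencil l (int m - int n))"

definition l2_seqs :: "(nat \<Rightarrow> real) set" where
  "l2_seqs = {u. summable (\<lambda>n. (u n)\<^sup>2)}"

definition symmetric_form :: "((nat \<Rightarrow> real) \<Rightarrow> (nat \<Rightarrow> real) \<Rightarrow> real) \<Rightarrow> bool" where
  "symmetric_form B \<longleftrightarrow>
     (\<forall>u\<in>l2_seqs. \<forall>v\<in>l2_seqs. B u v = B v u) \<and>
     (\<forall>u\<in>l2_seqs. \<forall>v\<in>l2_seqs. \<forall>w\<in>l2_seqs. \<forall>x y.
        B (\<lambda>n. x * u n + y * v n) w = x * B u w + y * B v w)"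

text \<open>
  Stability by the energy method: for a discrete inner product \<open>B\<close> equivalent to that of \<open>l2\<close> and a
  nonnegative form \<open>A\<close>, the energy \<open>E = B(u_t, u_t) + A(u, u) / h^2\<close> does not grow along
  \<open>u_tt = Q u / h^2\<close>. The last line is \<open>dE/dt \<le> 0\<close>, as \<open>dE/dt = 2 (B(u_t, Q u) + A(u, u_t)) / h^2\<close>
  and the state \<open>(u, u_t)\<close> is arbitrary.
\<close>

definition energy_stable :: "(nat \<Rightarrow> nat \<Rightarrow> real) \<Rightarrow> bool" where
  "energy_stable Q \<longleftrightarrow>
     (\<exists>B A. symmetric_form B \<and> symmetric_form A \<and>
        (\<exists>c > 0. \<exists>M. \<forall>u\<in>l2_seqs.
           c * (\<Sum>n. (u n)\<^sup>2) \<le> B u u \<and> B u u \<le> M * (\<Sum>n. (u n)\<^sup>2)) \<and>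
        (\<forall>u\<in>l2_seqs. 0 \<le> A u u) \<and>
        (\<forall>u\<in>l2_seqs. \<forall>v\<in>l2_seqs. B v (apply_op Q u) + A u v \<le> 0))"

text \<open>
  \<open>s\<close> below is the scaled variable. The equation results from inserting \<open>\<zeta>_n = z^n\<close> into
  \<open>s^2 \<zeta> = Q \<zeta>\<close> in an interior row, divided by a power of \<open>z\<close>.
\<close>

definition characteristic_eq :: "nat \<Rightarrow> complex \<Rightarrow> complex \<Rightarrow> bool" where
  "characteristic_eq l s z \<longleftrightarrow>
     s\<^sup>2 * z ^ l = (\<Sum>m\<le>2 * l. of_real (central_stencil l (int m - int l)) * z ^ m)"

text \<open>
  \<open>\<kappa>_0, ..., \<kappa>_{l-1}\<close> are the admissible roots in the strip \<open>0 < Re s < r\<close>, extended to the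
  imaginary axis by continuity. Two of the roots may coincide at points with larger \<open>Re s\<close>
  (for \<open>l = 2\<close> at \<open>s = sqrt 3\<close>), where the sum of pure powers is not the general \<open>l2\<close> solution
  and around which the roots cannot be labelled continuously; hence the strip.
\<close>

definition admissible_roots :: "nat \<Rightarrow> real \<Rightarrow> (nat \<Rightarrow> complex \<Rightarrow> complex) \<Rightarrow> bool" where
  "admissible_roots l r \<kappa> \<longleftrightarrow>
     (\<forall>s. 0 < Re s \<and> Re s < r \<longrightarrow>
        bij_betw (\<lambda>j. \<kappa> j s) {..<l} {z. characteristic_eq l s z \<and> cmod z < 1}) \<and>
     (\<forall>j<l. continuous_on {s. 0 \<le> Re s \<and> Re s < r} (\<kappa> j))"

text \<open>
  The general solution is \<open>\<zeta> = \<Sum>_{c < d+l} \<Sigma>_c (ansatz d \<kappa> s c)\<close> with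
  \<open>\<Sigma> = [\<zeta>_0, ..., \<zeta>_{d-1}, \<sigma>_0, ..., \<sigma>_{l-1}]\<close>; column \<open>c\<close> of the determinant matrix is the
  first part of \<open>(s^2 - Q) (ansatz d \<kappa> s c)\<close>.
\<close>

definition ansatz :: "nat \<Rightarrow> (nat \<Rightarrow> complex \<Rightarrow> complex) \<Rightarrow> complex \<Rightarrow> nat \<Rightarrow> nat \<Rightarrow> complex" where
  "ansatz d \<kappa> s c n =
     (if c < d then (if n = c then 1 else 0)
      else (if n < d then 0 else \<kappa> (c - d) s ^ (n - d)))"

definition determinant_matrix ::
    "nat \<Rightarrow> nat \<Rightarrow> (nat \<Rightarrow> nat \<Rightarrow> real) \<Rightarrow> (nat \<Rightarrow> complex \<Rightarrow> complex) \<Rightarrow> complex \<Rightarrow> complex mat" where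
  "determinant_matrix l d Q \<kappa> s =
     mat (d + l) (d + l)
       (\<lambda>(n, c). s\<^sup>2 * ansatz d \<kappa> s c n - apply_op Q (ansatz d \<kappa> s c) n)"

text \<open>
  \<open>U i j x t\<close> is the derivative of order \<open>i\<close> in \<open>x\<close> and \<open>j\<close> in \<open>t\<close> of the solution \<open>U 0 0\<close>,
  up to and including the boundary of the quarter plane (one-sided derivatives there).
\<close>

definition smooth_wave_solution :: "(nat \<Rightarrow> nat \<Rightarrow> real \<Rightarrow> real \<Rightarrow> real) \<Rightarrow> bool" where
  "smooth_wave_solution U \<longleftrightarrow>
     (\<forall>i j. continuous_on ({0..} \<times> {0..}) (\<lambda>(x, t). U i j x t)) \<and>
     (\<forall>i j. \<forall>x\<ge>0. \<forall>t\<ge>0.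
        ((\<lambda>y. U i j y t) has_real_derivative U (Suc i) j x t) (at x within {0..}) \<and>
        ((\<lambda>\<tau>. U i j x \<tau>) has_real_derivative U i (Suc j) x t) (at t within {0..})) \<and>
     (\<forall>x\<ge>0. \<forall>t\<ge>0. U 0 2 x t = U 2 0 x t) \<and>
     (\<forall>t\<ge>0. set_integrable lborel {0..} (\<lambda>x. (U 0 0 x t)\<^sup>2))"

text \<open>
  Compatibility to order \<open>N\<close>: the spatial derivatives of both initial data vanish at the boundary.
  By the wave equation the temporal derivatives of the boundary data at \<open>t = 0\<close> then vanish as well.
\<close>

definition compatible_data :: "nat \<Rightarrow> (nat \<Rightarrow> nat \<Rightarrow> real \<Rightarrow> real \<Rightarrow> real) \<Rightarrow> bool" where
  "compatible_data N U \<longleftrightarrow> (\<forall>i<N. U i 0 0 0 = 0 \<and> U i 1 0 0 = 0)"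

definition laplace :: "(real \<Rightarrow> real) \<Rightarrow> complex \<Rightarrow> complex" where
  "laplace f s = set_lebesgue_integral lborel {0..} (\<lambda>t. exp (- s * of_real t) * of_real (f t))"

text \<open>
  \<open>boundary_truncation p k a U j i\<close> is the time derivative of order \<open>j\<close> of
  \<open>T_i(t) = a_i U^(p+2,0)(0,t)\<close>, padded with zeros for \<open>i > k\<close>.
\<close>

definition boundary_truncation ::
    "nat \<Rightarrow> nat \<Rightarrow> (nat \<Rightarrow> real) \<Rightarrow> (nat \<Rightarrow> nat \<Rightarrow> real \<Rightarrow> real \<Rightarrow> real) \<Rightarrow> nat \<Rightarrow> nat \<Rightarrow> real \<Rightarrow> real" where
  "boundary_truncation p k a U j i t = (if i \<le> k then a i * U (p + 2) j 0 t else 0)"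

definition laplace_vec :: "nat \<Rightarrow> (nat \<Rightarrow> real \<Rightarrow> real) \<Rightarrow> complex \<Rightarrow> complex Matrix.vec" where
  "laplace_vec N f s = Matrix.vec N (\<lambda>i. laplace (f i) s)"

definition max_norm :: "complex Matrix.vec \<Rightarrow> real" where
  "max_norm v = Max ((\<lambda>i. cmod (vec_index v i)) ` {..<dim_vec v})"

end

theory Submission
  imports Defs "HOL-Computational_Algebra.Fundamental_Theorem_Algebra"
begin

text \<open>
  A solution \<open>\<Sigma>\<close> of the boundary system defines an \<open>l2\<close> solution \<open>\<zeta>\<close> of \<open>s^2 \<zeta> - Q \<zeta> = f\<close>, where \<open>f\<close>
  is the right-hand side padded with zeros. Energy stability gives \<open>Re s |s| \<parallel>\<zeta>\<parallel> \<le> K \<parallel>f\<parallel>\<close>. The first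
  \<open>d\<close> components of \<open>\<Sigma>\<close> are components of \<open>\<zeta>\<close>; the \<open>\<sigma>_j\<close> are recovered from \<open>\<zeta>\<close> at a cost of
  negative powers of \<open>|\<kappa>_i - \<kappa>_j|\<close>. The roots of the characteristic equation can only collide at
  finitely many \<open>s\<close>, none of them in the open strip, so these distances are bounded below by a power of
  \<open>Re s / (1 + |s|)\<close>. Altogether \<open>C(s)^{-1}\<close> grows at most like a power of \<open>(1 + |s|) / Re s\<close>, which
  is \<open>w\<close> powers of \<open>1 / (\<eta> h)\<close> near the origin. Away from it the powers of \<open>|s|\<close> turn into time derivatives
  of the data, because \<open>(d/dt)^\<alpha>\<close> becomes multiplication by the unscaled \<open>s^\<alpha>\<close> for compatible data.
\<close>

section \<open>Energy estimate for the resolvent\<close>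

lemma l2_seqs_lincomb:
  assumes "u \<in> l2_seqs" "v \<in> l2_seqs"
  shows "(\<lambda>n. x * u n + y * v n) \<in> l2_seqs"
proof -
  have "summable (\<lambda>n. 2 * x\<^sup>2 * (u n)\<^sup>2 + 2 * y\<^sup>2 * (v n)\<^sup>2)"
    using assms unfolding l2_seqs_def by (intro summable_add summable_mult) auto
  moreover have "(x * u n + y * v n)\<^sup>2 \<le> 2 * x\<^sup>2 * (u n)\<^sup>2 + 2 * y\<^sup>2 * (v n)\<^sup>2" for n
    using sum_squares_ge_zero[of "x * u n - y * v n" 0] by (simp add: power2_eq_square algebra_simps)
  ultimately show ?thesis
    unfolding l2_seqs_def by (auto intro: summable_comparison_test')
qed

lemma symmetric_form_commute:
  "symmetric_form B \<Longrightarrow> u \<in> l2_seqs \<Longrightarrow> v \<in> l2_seqs \<Longrightarrow> B u v = B v u"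
  unfolding symmetric_form_def by blast

lemma symmetric_form_lincomb_left:
  assumes "symmetric_form B" "u \<in> l2_seqs" "v \<in> l2_seqs" "w \<in> l2_seqs"
  shows "B (\<lambda>n. x * u n + y * v n) w = x * B u w + y * B v w"
  using assms unfolding symmetric_form_def by blast

lemma symmetric_form_lincomb_right:
  assumes "symmetric_form B" "u \<in> l2_seqs" "v \<in> l2_seqs" "w \<in> l2_seqs"
  shows "B w (\<lambda>n. x * u n + y * v n) = x * B w u + y * B w v"
  using symmetric_form_lincomb_left[OF assms]
    symmetric_form_commute[OF assms(1) assms(4) l2_seqs_lincomb[OF assms(2,3)]]
    symmetric_form_commute[OF assms(1,4,2)] symmetric_form_commute[OF assms(1,4,3)]
  by simp

text \<open>Expansion of \<open>B\<close> at \<open>e u - v\<close>, where the form is nonnegative.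
  The weight \<open>e\<close> will be \<open>Re s\<close>, so that half of the dissipation absorbs
  the right-hand side.\<close>

lemma symmetric_form_young:
  assumes B: "symmetric_form B" and pos: "\<And>u. u \<in> l2_seqs \<Longrightarrow> 0 \<le> B u u"
    and u: "u \<in> l2_seqs" and v: "v \<in> l2_seqs"
  shows "2 * e * B u v \<le> e\<^sup>2 * B u u + B v v"
proof -
  let ?w = "\<lambda>n. e * u n + (-1) * v n"
  have w: "?w \<in> l2_seqs" by (rule l2_seqs_lincomb[OF u v])
  have "B ?w ?w = e * B u ?w + (-1) * B v ?w"
    using symmetric_form_lincomb_left[OF B u v w] .
  also have "\<dots> = e * (e * B u u + (-1) * B u v) + (-1) * (e * B v u + (-1) * B v v)"
    by (simp only: symmetric_form_lincomb_right[OF B u v u] symmetric_form_lincomb_right[OF B u v v])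
  also have "B v u = B u v" by (rule symmetric_form_commute[OF B v u])
  finally have "B ?w ?w = e\<^sup>2 * B u u - 2 * e * B u v + B v v"
    by (simp add: power2_eq_square algebra_simps)
  with pos[OF w] show ?thesis by linarith
qed

lemma Re_apply_op: "Re (apply_op Q u n) = apply_op Q (\<lambda>m. Re (u m)) n"
  by (simp add: apply_op_def)

lemma Im_apply_op: "Im (apply_op Q u n) = apply_op Q (\<lambda>m. Im (u m)) n"
  by (simp add: apply_op_def)

text \<open>
  Testing the resolvent equation with \<open>s \<zeta>\<close> in the energy form: the \<open>A\<close>-terms are nonnegative,
  because \<open>A(x, Re (s \<zeta>)) + A(y, Im (s \<zeta>)) = Re s (A(x, x) + A(y, y))\<close> for \<open>\<zeta> = x + i y\<close>.
\<close>

lemma energy_resolvent_bound: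
  assumes "energy_stable Q"
  obtains K where "K > 0"
    and "\<And>\<zeta> f s n. summable (\<lambda>n. (cmod (\<zeta> n))\<^sup>2) \<Longrightarrow> summable (\<lambda>n. (cmod (f n))\<^sup>2) \<Longrightarrow> 0 < Re s \<Longrightarrow>
      (\<And>n. s\<^sup>2 * \<zeta> n - apply_op Q \<zeta> n = f n) \<Longrightarrow>
      (Re s * cmod s * cmod (\<zeta> n))\<^sup>2 \<le> K * (\<Sum>n. (cmod (f n))\<^sup>2)"
proof -
  obtain B A c M where B: "symmetric_form B" and A: "symmetric_form A" and c: "c > 0"
    and lo: "\<And>u. u \<in> l2_seqs \<Longrightarrow> c * (\<Sum>n. (u n)\<^sup>2) \<le> B u u"
    and up: "\<And>u. u \<in> l2_seqs \<Longrightarrow> B u u \<le> M * (\<Sum>n. (u n)\<^sup>2)"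
    and Apos: "\<And>u. u \<in> l2_seqs \<Longrightarrow> 0 \<le> A u u"
    and diss: "\<And>u v. u \<in> l2_seqs \<Longrightarrow> v \<in> l2_seqs \<Longrightarrow> B v (apply_op Q u) + A u v \<le> 0"
    using assms unfolding energy_stable_def by metis
  have Bpos: "0 \<le> B u u" if "u \<in> l2_seqs" for u
  proof -
    have "0 \<le> (\<Sum>n. (u n)\<^sup>2)" using that unfolding l2_seqs_def by (auto intro: suminf_nonneg)
    then have "0 \<le> c * (\<Sum>n. (u n)\<^sup>2)" using c by simp
    with lo[OF that] show ?thesis by linarith
  qed
  have Re_l2: "(\<lambda>n. Re (z n)) \<in> l2_seqs" and Im_l2: "(\<lambda>n. Im (z n)) \<in> l2_seqs"
    if "summable (\<lambda>n. (cmod (z n))\<^sup>2)" for z :: "nat \<Rightarrow> complex"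
    using that unfolding l2_seqs_def
    by (auto intro!: summable_comparison_test'[OF that] simp: cmod_power2)
  have suminf_cmod: "(\<Sum>n. (cmod (z n))\<^sup>2) = (\<Sum>n. (Re (z n))\<^sup>2) + (\<Sum>n. (Im (z n))\<^sup>2)"
    if "summable (\<lambda>n. (cmod (z n))\<^sup>2)" for z :: "nat \<Rightarrow> complex"
    using Re_l2[OF that] Im_l2[OF that] unfolding l2_seqs_def by (simp add: cmod_power2 suminf_add)
  show ?thesis
  \<comment> \<open>The sign of \<open>M\<close> is not known, hence
    \<open>\<bar>M\<bar> + 1\<close>; dividing by \<open>c\<close> returns from the
    \<open>B\<close>-norm to the l2 norm.\<close>
  proof (rule that[of "(\<bar>M\<bar> + 1) / c"])
    show "(\<bar>M\<bar> + 1) / c > 0" using c by simp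
  next
    fix \<zeta> f :: "nat \<Rightarrow> complex" and s :: complex and n :: nat
    assume \<zeta>: "summable (\<lambda>n. (cmod (\<zeta> n))\<^sup>2)" and f: "summable (\<lambda>n. (cmod (f n))\<^sup>2)"
      and s: "0 < Re s" and eq: "\<And>n. s\<^sup>2 * \<zeta> n - apply_op Q \<zeta> n = f n"
    define a b where "a = Re s" and "b = Im s"
    define x y where "x = (\<lambda>n. Re (\<zeta> n))" and "y = (\<lambda>n. Im (\<zeta> n))"
    define g k where "g = (\<lambda>n. Re (f n))" and "k = (\<lambda>n. Im (f n))"
    \<comment> \<open>The real and imaginary parts of \<open>s * \<zeta>\<close>. Since
      \<open>Q\<close> is real, the equation splits into one for \<open>x\<close> and one for
      \<open>y\<close>.\<close>
    define v w where "v = (\<lambda>n. a * x n + (- b) * y n)" and "w = (\<lambda>n. b * x n + a * y n)"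
    have x: "x \<in> l2_seqs" and y: "y \<in> l2_seqs" unfolding x_def y_def using Re_l2[OF \<zeta>] Im_l2[OF \<zeta>] by auto
    have g: "g \<in> l2_seqs" and k: "k \<in> l2_seqs" unfolding g_def k_def using Re_l2[OF f] Im_l2[OF f] by auto
    have v: "v \<in> l2_seqs" and w: "w \<in> l2_seqs" unfolding v_def w_def by (rule l2_seqs_lincomb[OF x y])+
    have sz: "s * \<zeta> n = Complex (v n) (w n)" for n
      by (simp add: complex_eq_iff v_def w_def a_def b_def x_def y_def algebra_simps)
    have ssz: "s\<^sup>2 * \<zeta> n = Complex (a * v n + (- b) * w n) (b * v n + a * w n)" for n
    proof -
      have "s\<^sup>2 * \<zeta> n = s * Complex (v n) (w n)" using sz[of n] by (simp add: power2_eq_square mult.assoc)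
      then show ?thesis by (simp add: complex_eq_iff a_def b_def algebra_simps)
    qed
    define p q where "p = (\<lambda>n. a * v n + (- b) * w n)" and "q = (\<lambda>n. b * v n + a * w n)"
    have p: "p \<in> l2_seqs" and q: "q \<in> l2_seqs" unfolding p_def q_def by (rule l2_seqs_lincomb[OF v w])+
    have Qx: "apply_op Q x = (\<lambda>n. 1 * p n + (-1) * g n)"
    proof
      fix n
      have "Re (s\<^sup>2 * \<zeta> n - apply_op Q \<zeta> n) = Re (f n)" by (simp add: eq)
      then show "apply_op Q x n = 1 * p n + (-1) * g n"
        unfolding ssz by (simp add: Re_apply_op x_def p_def g_def)
    qed
    have Qy: "apply_op Q y = (\<lambda>n. 1 * q n + (-1) * k n)"
    proof
      fix n
      have "Im (s\<^sup>2 * \<zeta> n - apply_op Q \<zeta> n) = Im (f n)" by (simp add: eq)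
      then show "apply_op Q y n = 1 * q n + (-1) * k n"
        unfolding ssz by (simp add: Im_apply_op y_def q_def k_def)
    qed
    \<comment> \<open>The dissipation inequality is used for the states \<open>(x, v)\<close> and
      \<open>(y, w)\<close>. In the sum of the two the mixed terms with factor \<open>b\<close>
      cancel, both in \<open>B\<close> and in \<open>A\<close>.\<close>
    have "B v (apply_op Q x) = B v p - B v g"
      unfolding Qx by (subst symmetric_form_lincomb_right[OF B p g v]) simp
    moreover have "B w (apply_op Q y) = B w q - B w k"
      unfolding Qy by (subst symmetric_form_lincomb_right[OF B q k w]) simp
    moreover have "B v p = a * B v v + (- b) * B v w"
      unfolding p_def by (rule symmetric_form_lincomb_right[OF B v w v])
    moreover have "B w q = b * B w v + a * B w w"
      unfolding q_def by (rule symmetric_form_lincomb_right[OF B v w w])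
    moreover have "B w v = B v w" by (rule symmetric_form_commute[OF B w v])
    moreover have "A x v = a * A x x + (- b) * A x y"
      unfolding v_def by (rule symmetric_form_lincomb_right[OF A x y x])
    moreover have "A y w = b * A y x + a * A y y"
      unfolding w_def by (rule symmetric_form_lincomb_right[OF A x y y])
    moreover have "A y x = A x y" by (rule symmetric_form_commute[OF A y x])
    moreover have "0 \<le> a * A x x" "0 \<le> a * A y y" using Apos x y s by (auto simp: a_def)
    ultimately have "a * B v v + a * B w w \<le> B v g + B w k"
      using diss[OF x v] diss[OF y w] by simp
    moreover have a: "a > 0" using s by (simp add: a_def)
    \<comment> \<open>After multiplication by \<open>2 * a\<close>, Young's inequality with
      \<open>e = a\<close> moves half of the left side across.\<close>
    ultimately have "2 * a * (a * B v v + a * B w w) \<le> 2 * a * B v g + 2 * a * B w k"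
      using mult_left_mono[of "a * B v v + a * B w w" "B v g + B w k" "2 * a"] by (simp only: distrib_left)
    also have "\<dots> \<le> (a\<^sup>2 * B v v + B g g) + (a\<^sup>2 * B w w + B k k)"
      by (intro add_mono symmetric_form_young[OF B Bpos] v g w k)
    finally have "a\<^sup>2 * (B v v + B w w) \<le> B g g + B k k"
      by (simp add: power2_eq_square algebra_simps)
    also have "\<dots> \<le> M * (\<Sum>n. (cmod (f n))\<^sup>2)"
      using up[OF g] up[OF k] unfolding suminf_cmod[OF f] g_def k_def by (simp add: algebra_simps)
    also have "\<dots> \<le> (\<bar>M\<bar> + 1) * (\<Sum>n. (cmod (f n))\<^sup>2)"
      by (intro mult_right_mono suminf_nonneg f) auto
    finally have 1: "a\<^sup>2 * (B v v + B w w) \<le> (\<bar>M\<bar> + 1) * (\<Sum>n. (cmod (f n))\<^sup>2)" .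
    have "(v n)\<^sup>2 \<le> (\<Sum>n. (v n)\<^sup>2)" "(w n)\<^sup>2 \<le> (\<Sum>n. (w n)\<^sup>2)"
      using v w sum_le_suminf[of "\<lambda>n. (v n)\<^sup>2" "{n}"] sum_le_suminf[of "\<lambda>n. (w n)\<^sup>2" "{n}"]
      unfolding l2_seqs_def by auto
    then have "c * ((v n)\<^sup>2 + (w n)\<^sup>2) \<le> c * (\<Sum>n. (v n)\<^sup>2) + c * (\<Sum>n. (w n)\<^sup>2)"
      using c by (simp flip: distrib_left)
    also have "\<dots> \<le> B v v + B w w" using lo[OF v] lo[OF w] by simp
    also have "(v n)\<^sup>2 + (w n)\<^sup>2 = (cmod s * cmod (\<zeta> n))\<^sup>2"
      by (metis sz complex_norm norm_mult real_sqrt_pow2 sum_power2_ge_zero)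
    finally have "a\<^sup>2 * (c * (cmod s * cmod (\<zeta> n))\<^sup>2) \<le> a\<^sup>2 * (B v v + B w w)"
      by (intro mult_left_mono) auto
    with 1 have "c * (a * cmod s * cmod (\<zeta> n))\<^sup>2 \<le> (\<bar>M\<bar> + 1) * (\<Sum>n. (cmod (f n))\<^sup>2)"
      by (simp add: power_mult_distrib algebra_simps)
    then show "(Re s * cmod s * cmod (\<zeta> n))\<^sup>2 \<le> (\<bar>M\<bar> + 1) / c * (\<Sum>n. (cmod (f n))\<^sup>2)"
      using c by (simp add: field_simps a_def)
  qed
qed

section \<open>Roots of the characteristic equation\<close>

lemma central_stencil_minus: "central_stencil l (- m) = central_stencil l m"
  by (simp add: central_stencil_def mult.commute mult.left_commute)

lemma central_stencil_eq_0: "\<bar>m\<bar> > int l \<Longrightarrow> central_stencil l m = 0"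
  by (auto simp: central_stencil_def)

lemma central_stencil_neq_0: "l \<ge> 1 \<Longrightarrow> central_stencil l (int l) \<noteq> 0"
  by (simp add: central_stencil_def)

text \<open>The Laurent symbol of the interior stencil times \<open>z ^ l\<close>, which makes it a
  polynomial.\<close>

definition stencil_poly :: "nat \<Rightarrow> complex poly" where
  "stencil_poly l = (\<Sum>m\<le>2 * l. monom (of_real (central_stencil l (int m - int l))) m)"

definition symbol_poly :: "nat \<Rightarrow> complex \<Rightarrow> complex poly" where
  "symbol_poly l s = stencil_poly l - monom (s\<^sup>2) l"

lemma coeff_stencil_poly:
  "coeff (stencil_poly l) m = of_real (central_stencil l (int m - int l))"
proof (cases "m \<le> 2 * l")
  case True
  then show ?thesis by (simp add: stencil_poly_def coeff_sum)
next
  case False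
  then show ?thesis by (simp add: stencil_poly_def coeff_sum central_stencil_eq_0)
qed

lemma poly_symbol_poly:
  "poly (symbol_poly l s) z
     = (\<Sum>m\<le>2 * l. of_real (central_stencil l (int m - int l)) * z ^ m) - s\<^sup>2 * z ^ l"
  by (simp add: symbol_poly_def stencil_poly_def poly_sum poly_monom)

lemma characteristic_eq_iff_root: "characteristic_eq l s z \<longleftrightarrow> poly (symbol_poly l s) z = 0"
  by (auto simp: characteristic_eq_def poly_symbol_poly)

lemma degree_symbol_poly:
  assumes "l \<ge> 1" shows "degree (symbol_poly l s) = 2 * l"
proof (rule antisym)
  show "degree (symbol_poly l s) \<le> 2 * l"
    by (rule degree_le) (auto simp: symbol_poly_def coeff_stencil_poly central_stencil_eq_0)
  show "2 * l \<le> degree (symbol_poly l s)"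
    using assms central_stencil_neq_0[of l]
    by (intro le_degree) (auto simp: symbol_poly_def coeff_stencil_poly)
qed

lemma poly_symbol_poly_0:
  assumes "l \<ge> 1" shows "poly (symbol_poly l s) 0 \<noteq> 0"
  using assms central_stencil_neq_0[of l] central_stencil_minus[of l "int l"]
  by (simp add: poly_0_coeff_0 symbol_poly_def coeff_stencil_poly)

text \<open>The stencil is even, so the polynomial is self-reciprocal and its roots come in pairs
  \<open>z\<close>, \<open>1 / z\<close>.\<close>

lemma poly_symbol_poly_inverse:
  assumes "z \<noteq> 0"
  shows "poly (symbol_poly l s) (inverse z) = poly (symbol_poly l s) z / z ^ (2 * l)"
proof -
  let ?c = "\<lambda>m. complex_of_real (central_stencil l (int m - int l))"
  have "(\<Sum>m\<le>2 * l. ?c m * inverse z ^ m) * z ^ (2 * l) = (\<Sum>m\<le>2 * l. ?c m * z ^ (2 * l - m))"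
    unfolding sum_distrib_right
  proof (rule sum.cong[OF refl])
    fix m assume "m \<in> {..2 * l}"
    then have "z ^ (2 * l) = z ^ m * z ^ (2 * l - m)" by (simp flip: power_add)
    then show "?c m * inverse z ^ m * z ^ (2 * l) = ?c m * z ^ (2 * l - m)"
      using assms by (simp add: power_inverse)
  qed
  also have "\<dots> = (\<Sum>m\<le>2 * l. ?c m * z ^ m)"
  proof (rule sum.reindex_bij_witness[of _ "\<lambda>m. 2 * l - m" "\<lambda>m. 2 * l - m"])
    fix m assume "m \<in> {..2 * l}"
    then have "int m - int l = - (int (2 * l - m) - int l)" by auto
    then have "?c (2 * l - m) = ?c m" by (metis central_stencil_minus)
    then show "?c (2 * l - m) * z ^ (2 * l - m) = ?c m * z ^ (2 * l - m)" by simp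
  qed auto
  finally have 1: "(\<Sum>m\<le>2 * l. ?c m * inverse z ^ m) * z ^ (2 * l) = (\<Sum>m\<le>2 * l. ?c m * z ^ m)" .
  have 2: "s\<^sup>2 * inverse z ^ l * z ^ (2 * l) = s\<^sup>2 * z ^ l"
    using assms by (simp add: power_inverse mult_2 power_add)
  show ?thesis
    unfolding poly_symbol_poly using assms 1 2 by (simp add: eq_divide_eq left_diff_distrib)
qed

text \<open>At a double root \<open>c\<close> the cofactor \<open>q\<close> of \<open>z - c\<close>
  still has all the roots of \<open>p\<close> but a smaller degree, which leaves too few distinct
  roots.\<close>

lemma simple_root_if_card_roots:
  fixes p :: "complex poly"
  assumes "p \<noteq> 0" "card {z. poly p z = 0} \<ge> degree p" "poly p c = 0"
  shows "poly (pderiv p) c \<noteq> 0"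
proof
  assume "poly (pderiv p) c = 0"
  from assms(3) obtain q where q: "p = [:-c, 1:] * q" by (metis dvdE poly_eq_0_iff_dvd)
  have "pderiv p = q + [:-c, 1:] * pderiv q" unfolding q pderiv_mult by (simp add: pderiv_pCons)
  then have "poly q c = 0" using \<open>poly (pderiv p) c = 0\<close> by simp
  then have "{z. poly p z = 0} \<subseteq> {z. poly q z = 0}" unfolding q by auto
  moreover have "q \<noteq> 0" using assms(1) q by auto
  ultimately have "card {z. poly p z = 0} \<le> degree q"
    using card_mono[OF poly_roots_finite[OF \<open>q \<noteq> 0\<close>]] card_poly_roots_bound[OF \<open>q \<noteq> 0\<close>] le_trans by blast
  moreover have "degree p = Suc (degree q)"
    unfolding q using \<open>q \<noteq> 0\<close> by (subst degree_mult_eq) auto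
  ultimately show False using assms(2) by simp
qed

text \<open>In the strip the \<open>l\<close> admissible roots and their inverses exhaust the \<open>2 l\<close> roots.\<close>

lemma symbol_poly_simple_roots:
  assumes l: "l \<ge> 1" and adm: "admissible_roots l r \<kappa>" and s: "0 < Re s" "Re s < r"
    and root: "poly (symbol_poly l s) c = 0"
  shows "poly (pderiv (symbol_poly l s)) c \<noteq> 0"
proof (rule simple_root_if_card_roots[OF _ _ root])
  let ?P = "symbol_poly l s"
  show P: "?P \<noteq> 0" using poly_symbol_poly_0[OF l, of s] by auto
  let ?I = "{z. characteristic_eq l s z \<and> cmod z < 1}"
  have bij: "bij_betw (\<lambda>j. \<kappa> j s) {..<l} ?I"
    using adm s unfolding admissible_roots_def by blast
  have card_I: "card ?I = l" and fin_I: "finite ?I"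
    using bij_betw_same_card[OF bij] bij_betw_finite[OF bij] by simp_all
  have nz: "z \<noteq> 0" if "z \<in> ?I" for z
    using that poly_symbol_poly_0[OF l, of s] by (auto simp: characteristic_eq_iff_root)
  have "card (inverse ` ?I) = l"
    using card_I by (subst card_image) (auto intro!: inj_onI)
  moreover have "?I \<inter> inverse ` ?I = {}"
  proof -
    have "cmod (inverse z) > 1" if "z \<in> ?I" for z
      using that nz[OF that] by (simp add: norm_inverse one_less_inverse_iff)
    then show ?thesis by force
  qed
  ultimately have "card (?I \<union> inverse ` ?I) = 2 * l"
    using card_I fin_I by (subst card_Un_disjoint) auto
  moreover have "?I \<union> inverse ` ?I \<subseteq> {z. poly ?P z = 0}"
    using nz by (auto simp: characteristic_eq_iff_root poly_symbol_poly_inverse)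
  ultimately show "card {z. poly ?P z = 0} \<ge> degree ?P"
    using card_mono[OF poly_roots_finite[OF P]] unfolding degree_symbol_poly[OF l] by metis
qed

section \<open>Quantitative bounds for complex polynomials\<close>

text \<open>Induction along Horner's scheme: for \<open>a + x p(x)\<close> the difference splits by
  the product rule into a bounded factor and the difference for \<open>p\<close>.\<close>

lemma poly_lipschitz_on_disc:
  fixes p :: "complex poly"
  obtains L where "L \<ge> 0"
    and "\<And>x y. cmod x \<le> R \<Longrightarrow> cmod y \<le> R \<Longrightarrow> cmod (poly p y - poly p x) \<le> L * cmod (y - x)"
proof -
  have "\<exists>L\<ge>0. \<forall>x y. cmod x \<le> R \<longrightarrow> cmod y \<le> R \<longrightarrow> cmod (poly p y - poly p x) \<le> L * cmod (y - x)"
  proof (induction p)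
    case 0
    show ?case by auto
  next
    case (pCons a p)
    then obtain L where L: "L \<ge> 0"
      "\<And>x y. cmod x \<le> R \<Longrightarrow> cmod y \<le> R \<Longrightarrow> cmod (poly p y - poly p x) \<le> L * cmod (y - x)" by blast
    obtain M where M: "M > 0" "\<And>z. cmod z \<le> R \<Longrightarrow> cmod (poly p z) \<le> M"
      using poly_bound_exists[of R p] by blast
    show ?case
    proof (intro exI[of _ "M + \<bar>R\<bar> * L"] conjI allI impI)
      fix x y assume xy: "cmod x \<le> R" "cmod y \<le> R"
      have "poly (pCons a p) y - poly (pCons a p) x = (y - x) * poly p y + x * (poly p y - poly p x)"
        by (simp add: algebra_simps)
      also have "cmod \<dots> \<le> cmod (y - x) * M + \<bar>R\<bar> * (L * cmod (y - x))"
        using xy by (intro norm_triangle_mono) (auto simp: norm_mult intro!: mult_mono L M)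
      finally show "cmod (poly (pCons a p) y - poly (pCons a p) x) \<le> (M + \<bar>R\<bar> * L) * cmod (y - x)"
        by (simp add: algebra_simps)
    qed (use L M in auto)
  qed
  with that show ?thesis by blast
qed

text \<open>The same induction one order higher; the extra term \<open>(y - x) * (p y - p x)\<close>
  is quadratic by the Lipschitz bound.\<close>

lemma poly_taylor_on_disc:
  fixes p :: "complex poly"
  obtains L where "L \<ge> 0"
    and "\<And>x y. cmod x \<le> R \<Longrightarrow> cmod y \<le> R \<Longrightarrow>
      cmod (poly p y - poly p x - poly (pderiv p) x * (y - x)) \<le> L * (cmod (y - x))\<^sup>2"
proof -
  have "\<exists>L\<ge>0. \<forall>x y. cmod x \<le> R \<longrightarrow> cmod y \<le> R \<longrightarrow>
      cmod (poly p y - poly p x - poly (pderiv p) x * (y - x)) \<le> L * (cmod (y - x))\<^sup>2"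
  proof (induction p)
    case 0
    show ?case by auto
  next
    case (pCons a p)
    then obtain L where L: "L \<ge> 0" "\<And>x y. cmod x \<le> R \<Longrightarrow> cmod y \<le> R \<Longrightarrow>
      cmod (poly p y - poly p x - poly (pderiv p) x * (y - x)) \<le> L * (cmod (y - x))\<^sup>2" by blast
    obtain M where M: "M \<ge> 0"
      "\<And>x y. cmod x \<le> R \<Longrightarrow> cmod y \<le> R \<Longrightarrow> cmod (poly p y - poly p x) \<le> M * cmod (y - x)"
      using poly_lipschitz_on_disc[of R p] by blast
    show ?case
    proof (intro exI[of _ "\<bar>R\<bar> * L + M"] conjI allI impI)
      fix x y assume xy: "cmod x \<le> R" "cmod y \<le> R"
      have "poly (pCons a p) y - poly (pCons a p) x - poly (pderiv (pCons a p)) x * (y - x)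
          = x * (poly p y - poly p x - poly (pderiv p) x * (y - x)) + (y - x) * (poly p y - poly p x)"
        by (simp add: pderiv_pCons algebra_simps)
      also have "cmod \<dots> \<le> \<bar>R\<bar> * (L * (cmod (y - x))\<^sup>2) + cmod (y - x) * (M * cmod (y - x))"
        using xy by (intro norm_triangle_mono) (auto simp: norm_mult intro!: mult_mono L M)
      finally show "cmod (poly (pCons a p) y - poly (pCons a p) x
          - poly (pderiv (pCons a p)) x * (y - x)) \<le> (\<bar>R\<bar> * L + M) * (cmod (y - x))\<^sup>2"
        by (simp add: algebra_simps power2_eq_square)
    qed (use L M in auto)
  qed
  with that show ?thesis by blast
qed

text \<open>Every linear factor costs one factor \<open>b\<close>, so \<open>m\<close> counts the
  roots with multiplicity. A polynomial without roots is constant by the fundamental theorem of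
  algebra.\<close>

lemma poly_lower_bound_by_root_distances:
  fixes p :: "complex poly"
  assumes "p \<noteq> 0"
  obtains K m where "K > 0"
    and "\<And>x b. b \<ge> 1 \<Longrightarrow> (\<And>c. poly p c = 0 \<Longrightarrow> 1 \<le> b * cmod (x - c)) \<Longrightarrow> 1 \<le> K * b ^ m * cmod (poly p x)"
proof -
  have "\<exists>K>0. \<exists>m. \<forall>x b. b \<ge> 1 \<longrightarrow> (\<forall>c. poly p c = 0 \<longrightarrow> 1 \<le> b * cmod (x - c)) \<longrightarrow>
      1 \<le> K * b ^ m * cmod (poly p x)"
    using assms
  proof (induction p rule: poly_root_induct[of _ "\<lambda>_. True"])
    case 0
    then show ?case by simp
  next
    case (no_roots p)
    then have "constant (poly p)" using fundamental_theorem_of_algebra by blast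
    then have const: "poly p x = poly p 0" for x unfolding constant_def by blast
    have nz: "poly p 0 \<noteq> 0" using no_roots by blast
    have "1 \<le> (1 / cmod (poly p 0)) * b ^ 0 * cmod (poly p x)" for x and b :: real
      using const[of x] nz by simp
    then show ?case using nz by (metis zero_less_divide_1_iff zero_less_norm_iff)
  next
    case (root a p)
    then have "p \<noteq> 0" by auto
    with root.IH obtain K m where K: "K > 0" and IH: "\<And>x b. b \<ge> 1 \<Longrightarrow>
      (\<And>c. poly p c = 0 \<Longrightarrow> 1 \<le> b * cmod (x - c)) \<Longrightarrow> 1 \<le> K * b ^ m * cmod (poly p x)" by auto
    show ?case
    proof (intro exI[of _ K] exI[of _ "Suc m"] conjI allI impI)
      fix x and b :: real
      assume b: "b \<ge> 1" and dist: "\<forall>c. poly ([:a, - 1:] * p) c = 0 \<longrightarrow> 1 \<le> b * cmod (x - c)"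
      have "1 \<le> K * b ^ m * cmod (poly p x)" using IH[OF b] dist by auto
      moreover have "1 \<le> b * cmod (x - a)" using dist by auto
      ultimately have "1 * 1 \<le> (K * b ^ m * cmod (poly p x)) * (b * cmod (x - a))"
        by (intro mult_mono) auto
      moreover have "poly ([:a, - 1:] * p) x = (a - x) * poly p x" by (simp add: algebra_simps)
      ultimately show "1 \<le> K * b ^ Suc m * cmod (poly ([:a, - 1:] * p) x)"
        by (simp only: norm_mult) (simp add: mult_ac norm_minus_commute)
    qed (rule K)
  qed
  with that show ?thesis by blast
qed

section \<open>Critical points and critical values of the symbol\<close>

text \<open>
  The roots of \<open>critical_poly l\<close> are the points \<open>z\<close> that are a double root of \<open>symbol_poly l s\<close> for
  some \<open>s\<close>, i.e. the critical points of the symbol \<open>stencil_poly l z / z^l = s^2\<close>.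
\<close>

definition critical_poly :: "nat \<Rightarrow> complex poly" where
  "critical_poly l = pCons 0 (pderiv (stencil_poly l)) - Polynomial.smult (of_nat l) (stencil_poly l)"

text \<open>At a root, \<open>s\<^sup>2 * z ^ l\<close> equals the value of
  \<open>stencil_poly l\<close>; this eliminates \<open>s\<close> from
  \<open>z P'(z)\<close>.\<close>

lemma poly_critical_poly:
  assumes "poly (symbol_poly l s) z = 0" "l \<ge> 1"
  shows "poly (critical_poly l) z = z * poly (pderiv (symbol_poly l s)) z"
proof -
  have "z * poly (pderiv (monom (s\<^sup>2) l)) z = of_nat l * (s\<^sup>2 * z ^ l)"
    using assms(2) by (simp add: pderiv_monom poly_monom flip: power_Suc)
  moreover have "poly (stencil_poly l) z = s\<^sup>2 * z ^ l"
    using assms by (simp add: symbol_poly_def poly_monom)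
  ultimately show ?thesis
    by (simp add: critical_poly_def symbol_poly_def pderiv_diff algebra_simps)
qed

lemma critical_poly_0:
  assumes "l \<ge> 1" shows "poly (critical_poly l) 0 \<noteq> 0"
  using poly_symbol_poly_0[OF assms, of 0] assms by (simp add: critical_poly_def symbol_poly_def)

text \<open>With \<mu> the principal root of \<open>a\<close>, \<open>a - s\<^sup>2\<close> factors
  as \<open>(\<mu> - s) * (\<mu> + s)\<close>. By \<open>strip\<close>, \<mu> is imaginary or has
  real part at least \<open>r\<close>; as \<open>Re s\<close> is at most \<open>r / 2\<close>, each
  factor has modulus at least \<open>Re s\<close>.\<close>

lemma square_diff_lower_bound:
  assumes s: "0 < Re s" "Re s \<le> r / 2"
    and strip: "\<And>t. 0 < Re t \<Longrightarrow> Re t < r \<Longrightarrow> t\<^sup>2 \<noteq> a"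
  shows "(Re s)\<^sup>2 \<le> cmod (a - s\<^sup>2)"
proof -
  define \<mu> where "\<mu> = csqrt a"
  have "Re \<mu> = 0 \<or> r \<le> Re \<mu>"
    using strip[of \<mu>] csqrt_principal[of a] unfolding \<mu>_def by fastforce
  then have "Re s \<le> \<bar>Re (\<mu> - s)\<bar>" "Re s \<le> \<bar>Re (\<mu> + s)\<bar>" using s by auto
  then have "Re s * Re s \<le> cmod (\<mu> - s) * cmod (\<mu> + s)"
    using s by (intro mult_mono) (auto intro: order_trans abs_Re_le_cmod simp del: minus_complex.simps plus_complex.simps)
  also have "\<dots> = cmod (a - s\<^sup>2)"
    by (simp add: \<mu>_def flip: norm_mult) (simp add: algebra_simps flip: power2_eq_square)
  finally show ?thesis by (simp add: power2_eq_square)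
qed

text \<open>At a critical point \<open>z\<close> the polynomial is
  \<open>z ^ l * (a - s\<^sup>2)\<close> with \<open>a\<close> the critical value. Roots in the
  strip are simple, so \<open>a\<close> is no square of a point there. The constant \<open>c\<close>
  exists because there are finitely many critical points, none of them zero.\<close>

lemma critical_value_lower_bound:
  assumes l: "l \<ge> 1" and adm: "admissible_roots l r \<kappa>" and r: "r > 0"
  obtains c where "c > 0"
    and "\<And>s z. 0 < Re s \<Longrightarrow> Re s \<le> r / 2 \<Longrightarrow> poly (critical_poly l) z = 0 \<Longrightarrow>
      c * (Re s)\<^sup>2 \<le> cmod (poly (symbol_poly l s) z)"
proof -
  let ?Z = "{z. poly (critical_poly l) z = 0}"
  have nz: "z \<noteq> 0" if "z \<in> ?Z" for z using that critical_poly_0[OF l] by auto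
  have fin: "finite ((\<lambda>z. cmod z ^ l) ` ?Z)"
    using critical_poly_0[OF l] by (intro finite_imageI poly_roots_finite) auto
  define c where "c = Min (insert 1 ((\<lambda>z. cmod z ^ l) ` ?Z))"
  show ?thesis
  proof (rule that[of c])
    have "c \<in> insert 1 ((\<lambda>z. cmod z ^ l) ` ?Z)"
      unfolding c_def by (rule Min_in) (use fin in simp_all)
    moreover have "cmod z ^ l > 0" if "z \<in> ?Z" for z using nz[OF that] by simp
    ultimately show "c > 0" by force
  next
    fix s z assume s: "0 < Re s" "Re s \<le> r / 2" and z: "poly (critical_poly l) z = 0"
    have "z \<noteq> 0" using nz z by simp
    define a where "a = poly (stencil_poly l) z / z ^ l"
    have P: "poly (symbol_poly l t) z = z ^ l * (a - t\<^sup>2)" for t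
      using \<open>z \<noteq> 0\<close> by (simp add: a_def symbol_poly_def poly_monom algebra_simps)
    have "t\<^sup>2 \<noteq> a" if t: "0 < Re t" "Re t < r" for t
    proof
      assume "t\<^sup>2 = a"
      then have root: "poly (symbol_poly l t) z = 0" by (simp add: P)
      then show False
        using symbol_poly_simple_roots[OF l adm t root] poly_critical_poly[OF root l] z \<open>z \<noteq> 0\<close> by simp
    qed
    then have "(Re s)\<^sup>2 \<le> cmod (a - s\<^sup>2)" using square_diff_lower_bound[OF s] by blast
    moreover have "c \<le> cmod z ^ l" unfolding c_def by (rule Min_le) (use fin z in simp_all)
    ultimately show "c * (Re s)\<^sup>2 \<le> cmod (poly (symbol_poly l s) z)"
      unfolding P norm_mult norm_power by (intro mult_mono) auto
  qed
qed

section \<open>Separation of the admissible roots\<close>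

text \<open>One scale for all losses: for \<open>0 < Re s \<le> 1\<close> it dominates both
  \<open>1 / Re s\<close> and \<open>1 + cmod s\<close>, so every bound is a single power of
  it.\<close>

definition growth :: "complex \<Rightarrow> real" where
  "growth s = (1 + cmod s) / Re s"

lemma growth_ge:
  assumes "0 < Re s" "Re s \<le> 1"
  shows "1 + cmod s \<le> growth s" "1 \<le> growth s" "1 / Re s \<le> growth s"
proof -
  show 1: "1 + cmod s \<le> growth s"
    unfolding growth_def using assms mult_left_mono[of "Re s" 1 "1 + cmod s"]
    by (simp add: pos_le_divide_eq)
  then show "1 \<le> growth s" using norm_ge_zero[of s] by linarith
  show "1 / Re s \<le> growth s" unfolding growth_def using assms by (intro divide_right_mono) auto
qed

lemma one_plus_square_le_growth:
  assumes "0 < Re s" "Re s \<le> 1"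
  shows "1 + (cmod s)\<^sup>2 \<le> (growth s)\<^sup>2"
proof -
  have "1 + (cmod s)\<^sup>2 \<le> (1 + cmod s)\<^sup>2" by (simp add: power2_eq_square algebra_simps)
  also have "\<dots> \<le> (growth s)\<^sup>2" using growth_ge(1)[OF assms] by (intro power_mono) auto
  finally show ?thesis .
qed

lemma admissible_rootD:
  assumes "admissible_roots l r \<kappa>" "0 < Re s" "Re s < r" "j < l"
  shows "poly (symbol_poly l s) (\<kappa> j s) = 0" "cmod (\<kappa> j s) < 1"
proof -
  have "bij_betw (\<lambda>j. \<kappa> j s) {..<l} {z. characteristic_eq l s z \<and> cmod z < 1}"
    using assms unfolding admissible_roots_def by blast
  then have "\<kappa> j s \<in> {z. characteristic_eq l s z \<and> cmod z < 1}"
    using assms(4) by (auto dest: bij_betwE)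
  then show "poly (symbol_poly l s) (\<kappa> j s) = 0" "cmod (\<kappa> j s) < 1"
    by (auto simp: characteristic_eq_iff_root)
qed

lemma admissible_roots_neq:
  assumes "admissible_roots l r \<kappa>" "0 < Re s" "Re s < r" "i < l" "j < l" "i \<noteq> j"
  shows "\<kappa> i s \<noteq> \<kappa> j s"
proof -
  have "bij_betw (\<lambda>j. \<kappa> j s) {..<l} {z. characteristic_eq l s z \<and> cmod z < 1}"
    using assms unfolding admissible_roots_def by blast
  then show ?thesis using assms(4-6) unfolding bij_betw_def inj_on_def by auto
qed

text \<open>
  A root \<open>\<kappa>\<close> of \<open>P = symbol_poly l s\<close> is far from every critical point \<open>c\<close>, as \<open>P(c)\<close> is not small;
  hence \<open>\<kappa> P'(\<kappa>) = critical_poly l (\<kappa>)\<close> is not small, and Taylor's formula separates \<open>\<kappa>\<close> from the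
  other roots.
\<close>

lemma admissible_roots_separated:
  assumes l: "l \<ge> 1" and adm: "admissible_roots l r \<kappa>" and r: "r > 0"
  obtains K m where "K > 0"
    and "\<And>s i j. 0 < Re s \<Longrightarrow> Re s \<le> min 1 (r / 2) \<Longrightarrow> i < l \<Longrightarrow> j < l \<Longrightarrow> i \<noteq> j \<Longrightarrow>
      1 \<le> K * growth s ^ m * cmod (\<kappa> i s - \<kappa> j s)"
proof -
  let ?N = "critical_poly l" and ?P = "symbol_poly l"
  have N: "?N \<noteq> 0" using critical_poly_0[OF l] by auto
  obtain c where c: "c > 0" and crit: "\<And>s z. 0 < Re s \<Longrightarrow> Re s \<le> r / 2 \<Longrightarrow> poly ?N z = 0 \<Longrightarrow>
      c * (Re s)\<^sup>2 \<le> cmod (poly (?P s) z)"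
    using critical_value_lower_bound[OF l adm r] by blast
  obtain K\<^sub>N m where KN: "K\<^sub>N > 0" and N_lower: "\<And>x b. b \<ge> 1 \<Longrightarrow>
      (\<And>c. poly ?N c = 0 \<Longrightarrow> 1 \<le> b * cmod (x - c)) \<Longrightarrow> 1 \<le> K\<^sub>N * b ^ m * cmod (poly ?N x)"
    using poly_lower_bound_by_root_distances[OF N] by blast
  \<comment> \<open>This disc contains the unit disc, where the admissible roots lie, and all
    critical points.\<close>
  define R where "R = Max (insert 1 (cmod ` {z. poly ?N z = 0}))"
  have fin: "finite (cmod ` {z. poly ?N z = 0})" by (intro finite_imageI poly_roots_finite N)
  have R1: "R \<ge> 1" and R: "\<And>z. poly ?N z = 0 \<Longrightarrow> cmod z \<le> R"
    unfolding R_def using fin by (auto intro!: Max_ge)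
  obtain L1 where L1: "L1 \<ge> 0" "\<And>x y. cmod x \<le> R \<Longrightarrow> cmod y \<le> R \<Longrightarrow>
      cmod (poly (stencil_poly l) y - poly (stencil_poly l) x) \<le> L1 * cmod (y - x)"
    using poly_lipschitz_on_disc[of R "stencil_poly l"] by blast
  obtain L2 where L2: "L2 \<ge> 0" "\<And>x y. cmod x \<le> R \<Longrightarrow> cmod y \<le> R \<Longrightarrow>
      cmod (poly (monom 1 l) y - poly (monom 1 l) x) \<le> L2 * cmod (y - x)"
    using poly_lipschitz_on_disc[of R "monom 1 l"] by blast
  obtain T1 where T1: "T1 \<ge> 0" "\<And>x y. cmod x \<le> R \<Longrightarrow> cmod y \<le> R \<Longrightarrow>
      cmod (poly (stencil_poly l) y - poly (stencil_poly l) x - poly (pderiv (stencil_poly l)) x * (y - x))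
        \<le> T1 * (cmod (y - x))\<^sup>2"
    using poly_taylor_on_disc[of R "stencil_poly l"] by blast
  obtain T2 where T2: "T2 \<ge> 0" "\<And>x y. cmod x \<le> R \<Longrightarrow> cmod y \<le> R \<Longrightarrow>
      cmod (poly (monom 1 l) y - poly (monom 1 l) x - poly (pderiv (monom 1 l)) x * (y - x))
        \<le> T2 * (cmod (y - x))\<^sup>2"
    using poly_taylor_on_disc[of R "monom 1 l"] by blast
  define L T where "L = L1 + L2 + 1" and "T = T1 + T2 + 1"
  have P: "?P s = stencil_poly l - Polynomial.smult (s\<^sup>2) (monom 1 l)" for s
    by (simp add: symbol_poly_def smult_monom)
  \<comment> \<open>The polynomial depends on \<open>s\<close> only through
    \<open>s\<^sup>2\<close>, so \<open>(growth s)\<^sup>2\<close> makes the Lipschitz and Taylor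
    constants uniform in \<open>s\<close>.\<close>
  have comb: "a + (cmod s)\<^sup>2 * b \<le> (a + b + 1) * (growth s)\<^sup>2"
    if "a \<ge> 0" "b \<ge> 0" "0 < Re s" "Re s \<le> 1" for a b s
  proof -
    have "a + (cmod s)\<^sup>2 * b \<le> (a + b + 1) * (1 + (cmod s)\<^sup>2)"
      using that by (simp add: algebra_simps)
    also have "\<dots> \<le> (a + b + 1) * (growth s)\<^sup>2"
      using that by (intro mult_left_mono one_plus_square_le_growth) auto
    finally show ?thesis .
  qed
  have lip: "cmod (poly (?P s) y - poly (?P s) x) \<le> L * (growth s)\<^sup>2 * cmod (y - x)"
    if xy: "cmod x \<le> R" "cmod y \<le> R" and s: "0 < Re s" "Re s \<le> 1" for x y s
  proof -
    have "poly (?P s) y - poly (?P s) x = (poly (stencil_poly l) y - poly (stencil_poly l) x)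
        - s\<^sup>2 * (poly (monom 1 l) y - poly (monom 1 l) x)"
      unfolding P by (simp add: algebra_simps)
    also have "cmod \<dots> \<le> L1 * cmod (y - x) + (cmod s)\<^sup>2 * (L2 * cmod (y - x))"
      by (rule norm_triangle_le_diff, rule add_mono)
        (auto simp: norm_mult norm_power intro!: mult_left_mono L1 L2 xy)
    also have "\<dots> = (L1 + (cmod s)\<^sup>2 * L2) * cmod (y - x)" by (simp add: algebra_simps)
    also have "\<dots> \<le> L * (growth s)\<^sup>2 * cmod (y - x)"
      unfolding L_def by (intro mult_right_mono comb L1 L2 s) auto
    finally show ?thesis .
  qed
  have taylor: "cmod (poly (?P s) y - poly (?P s) x - poly (pderiv (?P s)) x * (y - x))
      \<le> T * (growth s)\<^sup>2 * (cmod (y - x))\<^sup>2"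
    if xy: "cmod x \<le> R" "cmod y \<le> R" and s: "0 < Re s" "Re s \<le> 1" for x y s
  proof -
    have "poly (?P s) y - poly (?P s) x - poly (pderiv (?P s)) x * (y - x)
        = (poly (stencil_poly l) y - poly (stencil_poly l) x - poly (pderiv (stencil_poly l)) x * (y - x))
        - s\<^sup>2 * (poly (monom 1 l) y - poly (monom 1 l) x - poly (pderiv (monom 1 l)) x * (y - x))"
      unfolding P pderiv_diff pderiv_smult by (simp add: algebra_simps)
    also have "cmod \<dots> \<le> T1 * (cmod (y - x))\<^sup>2 + (cmod s)\<^sup>2 * (T2 * (cmod (y - x))\<^sup>2)"
      by (rule norm_triangle_le_diff, rule add_mono)
        (auto simp: norm_mult norm_power intro!: mult_left_mono T1 T2 xy)
    also have "\<dots> = (T1 + (cmod s)\<^sup>2 * T2) * (cmod (y - x))\<^sup>2" by (simp add: algebra_simps)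
    also have "\<dots> \<le> T * (growth s)\<^sup>2 * (cmod (y - x))\<^sup>2"
      unfolding T_def by (intro mult_right_mono comb T1 T2 s) auto
    finally show ?thesis .
  qed
  \<comment> \<open>The inverse distance from an admissible root to the critical points. Two of the
    four powers come from the Lipschitz constant, the other two from \<open>(Re s)\<^sup>2\<close>
    in the lower bound at critical points.\<close>
  define b where "b s = (1 + L / c) * growth s ^ 4" for s
  have Lc: "L / c \<ge> 0" "L > 0" "T > 0" using c L1 L2 T1 T2 by (auto simp: L_def T_def)
  show ?thesis
  proof (rule that[of "K\<^sub>N * (1 + L / c) ^ m * T" "4 * m + 2"])
    show "K\<^sub>N * (1 + L / c) ^ m * T > 0" using KN Lc by (intro mult_pos_pos zero_less_power) auto
  next
    fix s i j assume s: "0 < Re s" "Re s \<le> min 1 (r / 2)" and ij: "i < l" "j < l" "i \<noteq> j"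
    have s1: "Re s \<le> 1" and s2: "Re s \<le> r / 2" and s3: "Re s < r" using s r by auto
    note growth = growth_ge[OF s(1) s1]
    define x y where "x = \<kappa> i s" and "y = \<kappa> j s"
    have x: "poly (?P s) x = 0" "cmod x < 1" and y: "poly (?P s) y = 0" "cmod y < 1"
      unfolding x_def y_def using admissible_rootD[OF adm s(1) s3] ij by auto
    have "x \<noteq> y" unfolding x_def y_def using admissible_roots_neq[OF adm s(1) s3] ij by auto
    have "1 \<le> b s * cmod (x - z)" if z: "poly ?N z = 0" for z
    proof -
      have "c * (Re s)\<^sup>2 \<le> L * (growth s)\<^sup>2 * cmod (z - x)"
        using crit[OF s(1) s2 z] lip[of x z s] x R1 R[OF z] s(1) s1 by simp
      then have "c * (Re s)\<^sup>2 * (growth s)\<^sup>2 \<le> L * (growth s)\<^sup>2 * cmod (z - x) * (growth s)\<^sup>2"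
        by (intro mult_right_mono) auto
      also have "\<dots> = L * growth s ^ 4 * cmod (x - z)"
        by (simp add: norm_minus_commute flip: power_add)
      finally have "c * (Re s * growth s)\<^sup>2 \<le> L * growth s ^ 4 * cmod (x - z)"
        by (simp add: power_mult_distrib mult.assoc)
      moreover have "1 \<le> (Re s * growth s)\<^sup>2"
        using s(1) by (intro one_le_power) (simp add: growth_def)
      then have "c \<le> c * (Re s * growth s)\<^sup>2" using c by simp
      ultimately have "c \<le> L * growth s ^ 4 * cmod (x - z)" by linarith
      then have "1 \<le> L / c * growth s ^ 4 * cmod (x - z)"
        using c by (simp add: pos_le_divide_eq)
      also have "\<dots> \<le> b s * cmod (x - z)"
        unfolding b_def using growth(2) by (intro mult_right_mono) auto
      finally show ?thesis .
    qed
    moreover have "1 \<le> b s"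
      unfolding b_def using Lc growth(2) mult_mono[of 1 "1 + L / c" 1 "growth s ^ 4"]
      by (simp add: one_le_power)
    ultimately have "1 \<le> K\<^sub>N * b s ^ m * cmod (poly ?N x)" by (rule N_lower[rotated])
    also have "cmod (poly ?N x) \<le> cmod (poly (pderiv (?P s)) x)"
      unfolding poly_critical_poly[OF x(1) l] norm_mult using x(2) by (intro mult_left_le_one_le) auto
    \<comment> \<open>Both \<open>x\<close> and \<open>y\<close> are roots, so only the linear term
      is left in Taylor's formula; one factor \<open>cmod (y - x)\<close> is divided out.\<close>
    also have "cmod (poly (pderiv (?P s)) x) \<le> T * (growth s)\<^sup>2 * cmod (x - y)"
    proof -
      have "cmod (poly (pderiv (?P s)) x) * cmod (y - x) \<le> T * (growth s)\<^sup>2 * (cmod (y - x))\<^sup>2"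
        using taylor[of x y s] x y R1 s(1) s1 by (simp add: norm_mult)
      then show ?thesis using \<open>x \<noteq> y\<close>
        by (simp add: power2_eq_square norm_minus_commute flip: mult.assoc)
    qed
    finally have "1 \<le> K\<^sub>N * b s ^ m * (T * (growth s)\<^sup>2 * cmod (x - y))"
      using KN \<open>1 \<le> b s\<close> by (auto simp: mult_left_mono)
    also have "\<dots> = K\<^sub>N * (1 + L / c) ^ m * T * growth s ^ (4 * m + 2) * cmod (x - y)"
    proof -
      have "growth s ^ (4 * m + 2) = (growth s ^ 4) ^ m * (growth s)\<^sup>2"
        by (simp only: power_add power_mult)
      then show ?thesis by (simp only: b_def power_mult_distrib mult_ac)
    qed
    finally show "1 \<le> K\<^sub>N * (1 + L / c) ^ m * T * growth s ^ (4 * m + 2) * cmod (\<kappa> i s - \<kappa> j s)"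
      by (simp add: x_def y_def)
  qed
qed

section \<open>The determinant matrix\<close>

lemma apply_op_sum:
  fixes u :: "'i \<Rightarrow> nat \<Rightarrow> complex"
  shows "apply_op Q (\<lambda>m. \<Sum>c\<in>A. a c * u c m) n = (\<Sum>c\<in>A. a c * apply_op Q (u c) n)"
  unfolding apply_op_def sum_distrib_left scaleR_sum_right
  by (subst sum.swap) (simp add: scaleR_conv_of_real mult_ac)

text \<open>Such a row reaches only indices from \<open>n - l \<ge> d\<close> on, where the column
  is zero or a pure power of a root; the characteristic equation then applies.\<close>

lemma ansatz_interior_row:
  assumes Q: "half_line_scheme l d Q" and n: "n \<ge> d + l"
    and root: "c \<ge> d \<Longrightarrow> poly (symbol_poly l s) (\<kappa> (c - d) s) = 0"
  shows "apply_op Q (ansatz d \<kappa> s c) n = s\<^sup>2 * ansatz d \<kappa> s c n"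
proof -
  let ?S = "{n - l..n + l}"
  have Qn: "Q n m = central_stencil l (int m - int n)" for m
    using Q n unfolding half_line_scheme_def by blast
  have supp: "{m. Q n m \<noteq> 0} \<subseteq> ?S"
  proof
    fix m assume "m \<in> {m. Q n m \<noteq> 0}"
    then have "\<not> \<bar>int m - int n\<bar> > int l" using central_stencil_eq_0[of l "int m - int n"] Qn by auto
    then show "m \<in> ?S" by auto
  qed
  have "apply_op Q (ansatz d \<kappa> s c) n = (\<Sum>m\<in>?S. Q n m *\<^sub>R ansatz d \<kappa> s c m)"
    unfolding apply_op_def by (rule sum.mono_neutral_left[OF _ supp]) auto
  also have "\<dots> = s\<^sup>2 * ansatz d \<kappa> s c n"
  proof (cases "c < d")
    case True
    then show ?thesis using n by (auto simp: ansatz_def intro!: sum.neutral)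
  next
    case False
    define z where "z = \<kappa> (c - d) s"
    have "(\<Sum>m\<in>?S. Q n m *\<^sub>R ansatz d \<kappa> s c m)
        = (\<Sum>i\<le>2 * l. z ^ (n - l - d) * (of_real (central_stencil l (int i - int l)) * z ^ i))"
    proof (rule sum.reindex_bij_witness[of _ "\<lambda>i. n - l + i" "\<lambda>m. m - (n - l)"])
      fix m assume m: "m \<in> ?S"
      have split: "m - d = (n - l - d) + (m - (n - l))" using m n by auto
      have "ansatz d \<kappa> s c m = z ^ (m - d)" using False m n by (auto simp: ansatz_def z_def)
      then have 1: "ansatz d \<kappa> s c m = z ^ (n - l - d) * z ^ (m - (n - l))"
        by (simp only: split power_add)
      have 2: "int m - int n = int (m - (n - l)) - int l" using m n by auto
      show "z ^ (n - l - d) * (of_real (central_stencil l (int (m - (n - l)) - int l)) * z ^ (m - (n - l)))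
          = Q n m *\<^sub>R ansatz d \<kappa> s c m"
        unfolding Qn 1 2 scaleR_conv_of_real by (simp only: mult_ac)
    qed (use n in auto)
    also have "\<dots> = z ^ (n - l - d) * (s\<^sup>2 * z ^ l)"
      using root False by (simp add: poly_symbol_poly z_def flip: sum_distrib_left)
    also have "\<dots> = s\<^sup>2 * z ^ (n - d)"
    proof -
      have split: "n - d = (n - l - d) + l" using n by auto
      show ?thesis by (simp only: split power_add mult_ac)
    qed
    finally show ?thesis using False n by (simp add: ansatz_def z_def)
  qed
  finally show ?thesis .
qed

lemma summable_cmod_square_lincomb:
  fixes u :: "'i \<Rightarrow> nat \<Rightarrow> complex"
  assumes "finite A" "\<And>c. c \<in> A \<Longrightarrow> summable (\<lambda>n. (cmod (u c n))\<^sup>2)"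
  shows "summable (\<lambda>n. (cmod (\<Sum>c\<in>A. a c * u c n))\<^sup>2)"
  using assms
proof (induction A)
  case empty
  show ?case by simp
next
  case (insert c A)
  have bound: "(cmod (x + y))\<^sup>2 \<le> 2 * (cmod x)\<^sup>2 + 2 * (cmod y)\<^sup>2" for x y
  proof -
    have "(cmod (x + y))\<^sup>2 \<le> (cmod x + cmod y)\<^sup>2" by (intro power_mono norm_triangle_ineq) auto
    also have "\<dots> \<le> 2 * (cmod x)\<^sup>2 + 2 * (cmod y)\<^sup>2"
      using zero_le_power2[of "cmod x - cmod y"] by (simp add: power2_eq_square algebra_simps)
    finally show ?thesis .
  qed
  let ?g = "\<lambda>n. 2 * ((cmod (a c))\<^sup>2 * (cmod (u c n))\<^sup>2) + 2 * (cmod (\<Sum>c\<in>A. a c * u c n))\<^sup>2"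
  have g: "summable ?g" using insert by (intro summable_add summable_mult) auto
  have le: "(cmod (\<Sum>c\<in>insert c A. a c * u c n))\<^sup>2 \<le> ?g n" for n
    using bound[of "a c * u c n" "\<Sum>c\<in>A. a c * u c n"] insert.hyps
    by (simp add: norm_mult power_mult_distrib)
  show ?case
    by (rule summable_comparison_test'[OF g, of 0]) (simp only: real_norm_def abs_power2 le)
qed

lemma summable_ansatz:
  assumes "c \<ge> d \<Longrightarrow> cmod (\<kappa> (c - d) s) < 1"
  shows "summable (\<lambda>n. (cmod (ansatz d \<kappa> s c n))\<^sup>2)"
proof (cases "c < d")
  case True
  then show ?thesis
    by (intro summable_finite[of "{c}"]) (auto simp: ansatz_def)
next
  case False
  have "summable (\<lambda>n. ((cmod (\<kappa> (c - d) s))\<^sup>2) ^ n)"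
    using assms False by (intro summable_geometric) (simp add: power_less_one_iff abs_square_less_1)
  then have "summable (\<lambda>n. (cmod (ansatz d \<kappa> s c (n + d)))\<^sup>2)"
    using False by (simp add: ansatz_def norm_power power_mult[symmetric] mult.commute)
  then show ?thesis by (subst (asm) summable_iff_shift)
qed

section \<open>Coefficients of exponential sums\<close>

text \<open>
  The coefficient \<open>\<sigma>_j\<close> is isolated by the difference operators \<open>E - z_i\<close>, \<open>i \<noteq> j\<close>, where \<open>E\<close> is the
  shift: \<open>E - z_i\<close> multiplies \<open>z_k^m\<close> by \<open>z_k - z_i\<close> and at most doubles a bound, as \<open>|z_i| \<le> 1\<close>.
\<close>

lemma exponential_sum_difference_bound:
  fixes \<sigma> z :: "nat \<Rightarrow> complex"
  assumes F: "finite F" and z: "\<And>i. i \<in> F \<Longrightarrow> cmod (z i) \<le> 1"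
    and bound: "\<And>m. cmod (\<Sum>k<l. \<sigma> k * z k ^ m) \<le> Z"
  shows "cmod (\<Sum>k<l. \<sigma> k * (\<Prod>i\<in>F. z k - z i) * z k ^ m) \<le> 2 ^ card F * Z"
  using F z
proof (induction F arbitrary: m)
  case empty
  show ?case using bound by simp
next
  case (insert i F)
  let ?S = "\<lambda>m. \<Sum>k<l. \<sigma> k * (\<Prod>i\<in>F. z k - z i) * z k ^ m"
  have "(\<Sum>k<l. \<sigma> k * (\<Prod>i\<in>insert i F. z k - z i) * z k ^ m) = ?S (Suc m) - z i * ?S m"
    unfolding sum_distrib_left sum_subtractf[symmetric] prod.insert[OF insert.hyps]
    by (intro sum.cong) (simp_all add: algebra_simps)
  also have "cmod \<dots> \<le> 2 ^ card F * Z + 1 * (2 ^ card F * Z)"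
  proof (rule norm_triangle_le_diff, rule add_mono)
    have IH: "cmod (?S m) \<le> 2 ^ card F * Z" for m using insert by blast
    show "cmod (?S (Suc m)) \<le> 2 ^ card F * Z" by (rule IH)
    show "cmod (z i * ?S m) \<le> 1 * (2 ^ card F * Z)"
      unfolding norm_mult using insert.prems IH by (intro mult_mono) auto
  qed
  also have "\<dots> = 2 ^ card (insert i F) * Z"
    unfolding card_insert_disjoint[OF insert.hyps] by simp
  finally show ?case .
qed

text \<open>Applying the difference operators for all \<open>i \<noteq> j\<close> and taking
  \<open>m = 0\<close> leaves only \<open>\<sigma> j\<close> times the product of the
  \<open>z j - z i\<close>, each of modulus at least \<open>1 / b\<close>.\<close>

lemma exponential_sum_coefficient_bound:
  fixes \<sigma> z :: "nat \<Rightarrow> complex"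
  assumes j: "j < l" and z: "\<And>i. i < l \<Longrightarrow> cmod (z i) \<le> 1"
    and bound: "\<And>m. cmod (\<Sum>k<l. \<sigma> k * z k ^ m) \<le> Z"
    and sep: "\<And>i. i < l \<Longrightarrow> i \<noteq> j \<Longrightarrow> 1 \<le> b * cmod (z j - z i)" and b: "b \<ge> 1"
  shows "cmod (\<sigma> j) \<le> (2 * b) ^ l * Z"
proof -
  let ?F = "{..<l} - {j}"
  let ?p = "\<Prod>i\<in>?F. cmod (z j - z i)"
  have Z: "Z \<ge> 0" using bound[of 0] norm_ge_zero order_trans by blast
  have "(\<Sum>k<l. \<sigma> k * (\<Prod>i\<in>?F. z k - z i) * z k ^ 0) = (\<Sum>k\<in>{j}. \<sigma> k * (\<Prod>i\<in>?F. z k - z i) * z k ^ 0)"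
    using j by (intro sum.mono_neutral_right) auto
  then have "cmod (\<sigma> j) * ?p = cmod (\<Sum>k<l. \<sigma> k * (\<Prod>i\<in>?F. z k - z i) * z k ^ 0)"
    by (simp add: norm_mult prod_norm)
  also have "\<dots> \<le> 2 ^ card ?F * Z"
    by (rule exponential_sum_difference_bound[OF _ _ bound]) (use z in auto)
  finally have up: "cmod (\<sigma> j) * ?p \<le> 2 ^ card ?F * Z" .
  have "1 \<le> (\<Prod>i\<in>?F. b * cmod (z j - z i))" by (rule prod_ge_1) (use sep in auto)
  then have "1 \<le> b ^ card ?F * ?p" by (simp add: prod.distrib)
  then have "cmod (\<sigma> j) * 1 \<le> cmod (\<sigma> j) * (b ^ card ?F * ?p)" by (intro mult_left_mono) auto
  also have "\<dots> = b ^ card ?F * (cmod (\<sigma> j) * ?p)" by simp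
  also have "\<dots> \<le> b ^ card ?F * (2 ^ card ?F * Z)" using up b by (intro mult_left_mono) auto
  also have "\<dots> = (2 * b) ^ card ?F * Z" by (simp add: power_mult_distrib)
  also have "\<dots> \<le> (2 * b) ^ l * Z"
    using b j Z by (intro mult_right_mono power_increasing) auto
  finally show ?thesis by simp
qed

section \<open>Inverse bound in the strip\<close>

lemma determinant_matrix_mult_vec:
  assumes "\<Sigma> \<in> carrier_vec (d + l)" "n < d + l"
  shows "vec_index (determinant_matrix l d Q \<kappa> s *\<^sub>v \<Sigma>) n
    = (\<Sum>c<d + l. vec_index \<Sigma> c * (s\<^sup>2 * ansatz d \<kappa> s c n - apply_op Q (ansatz d \<kappa> s c) n))"
  using assms by (simp add: determinant_matrix_def scalar_prod_def mult.commute lessThan_atLeast0)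

text \<open>The inverse is estimated without being formed: \<Sigma> is bounded by its image, which
  includes injectivity of the matrix. The resolvent estimate bounds \<zeta>, and root separation
  recovers the coefficients from it.\<close>

lemma determinant_matrix_inverse_bound:
  assumes l: "l \<ge> 1" and Q: "half_line_scheme l d Q" and stable: "energy_stable Q"
    and r: "r > 0" and adm: "admissible_roots l r \<kappa>"
  obtains K m where "K > 0"
    and "\<And>s \<Sigma> M c. 0 < Re s \<Longrightarrow> Re s \<le> min 1 (r / 2) \<Longrightarrow> \<Sigma> \<in> carrier_vec (d + l) \<Longrightarrow>
      (\<And>n. n < d + l \<Longrightarrow> cmod (vec_index (determinant_matrix l d Q \<kappa> s *\<^sub>v \<Sigma>) n) \<le> M) \<Longrightarrow>
      c < d + l \<Longrightarrow> cmod (vec_index \<Sigma> c) \<le> K * growth s ^ m * M"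
proof -
  obtain K\<^sub>0 where K0: "K\<^sub>0 > 0"
    and resolvent: "\<And>\<zeta> f s n. summable (\<lambda>n. (cmod (\<zeta> n))\<^sup>2) \<Longrightarrow> summable (\<lambda>n. (cmod (f n))\<^sup>2) \<Longrightarrow> 0 < Re s \<Longrightarrow>
      (\<And>n. s\<^sup>2 * \<zeta> n - apply_op Q \<zeta> n = f n) \<Longrightarrow>
      (Re s * cmod s * cmod (\<zeta> n))\<^sup>2 \<le> K\<^sub>0 * (\<Sum>n. (cmod (f n))\<^sup>2)"
    using energy_resolvent_bound[OF stable] by blast
  obtain K\<^sub>2 m where K2: "K\<^sub>2 > 0"
    and sep: "\<And>s i j. 0 < Re s \<Longrightarrow> Re s \<le> min 1 (r / 2) \<Longrightarrow> i < l \<Longrightarrow> j < l \<Longrightarrow> i \<noteq> j \<Longrightarrow>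
      1 \<le> K\<^sub>2 * growth s ^ m * cmod (\<kappa> i s - \<kappa> j s)"
    using admissible_roots_separated[OF l adm r] by blast
  \<comment> \<open>The factor \<open>d + l\<close> passes from the l2 norm of the residual to the
    maximum over its \<open>d + l\<close> nonzero rows.\<close>
  define K\<^sub>1 where "K\<^sub>1 = sqrt (K\<^sub>0 * (d + l))"
  have K1: "K\<^sub>1 > 0" unfolding K\<^sub>1_def using K0 l by simp
  define b where "b s = (1 + K\<^sub>2) * growth s ^ m" for s
  show ?thesis
  proof (rule that[of "(2 * (1 + K\<^sub>2)) ^ l * K\<^sub>1" "m * l + 2"])
    show "(2 * (1 + K\<^sub>2)) ^ l * K\<^sub>1 > 0" using K1 K2 by simp
  next
    fix s \<Sigma> M c
    assume s: "0 < Re s" "Re s \<le> min 1 (r / 2)" and \<Sigma>: "\<Sigma> \<in> carrier_vec (d + l)"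
      and M: "\<And>n. n < d + l \<Longrightarrow> cmod (vec_index (determinant_matrix l d Q \<kappa> s *\<^sub>v \<Sigma>) n) \<le> M"
      and c: "c < d + l"
    have s1: "Re s \<le> 1" and s3: "Re s < r" using s r by auto
    note growth = growth_ge[OF s(1) s1]
    note root = admissible_rootD[OF adm s(1) s3]
    have M0: "M \<ge> 0" using M[OF c] norm_ge_zero order_trans by blast
    define \<zeta> where "\<zeta> n = (\<Sum>c<d + l. vec_index \<Sigma> c * ansatz d \<kappa> s c n)" for n
    \<comment> \<open>The residual coincides with the boundary system in the first
      \<open>d + l\<close> rows and vanishes in all later ones.\<close>
    define f where "f n = s\<^sup>2 * \<zeta> n - apply_op Q \<zeta> n" for n
    have f_eq: "f n = (\<Sum>c<d + l. vec_index \<Sigma> c * (s\<^sup>2 * ansatz d \<kappa> s c n - apply_op Q (ansatz d \<kappa> s c) n))" for n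
      unfolding f_def \<zeta>_def apply_op_sum
      by (simp add: sum_distrib_left sum_subtractf algebra_simps)
    have f_le: "cmod (f n) \<le> M" if "n < d + l" for n
      using M[OF that] unfolding f_eq determinant_matrix_mult_vec[OF \<Sigma> that] .
    have f_0: "f n = 0" if "n \<ge> d + l" for n
      unfolding f_eq
    proof (rule sum.neutral, rule ballI)
      fix c assume "c \<in> {..<d + l}"
      then have "apply_op Q (ansatz d \<kappa> s c) n = s\<^sup>2 * ansatz d \<kappa> s c n"
        by (intro ansatz_interior_row[OF Q that] root) auto
      then show "vec_index \<Sigma> c * (s\<^sup>2 * ansatz d \<kappa> s c n - apply_op Q (ansatz d \<kappa> s c) n) = 0" by simp
    qed
    have summ_\<zeta>: "summable (\<lambda>n. (cmod (\<zeta> n))\<^sup>2)"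
      unfolding \<zeta>_def by (intro summable_cmod_square_lincomb summable_ansatz root) auto
    have summ_f: "summable (\<lambda>n. (cmod (f n))\<^sup>2)"
      by (rule summable_finite[of "{..<d + l}"]) (auto simp: f_0)
    have res: "(Re s * cmod s * cmod (\<zeta> n))\<^sup>2 \<le> K\<^sub>0 * (\<Sum>n. (cmod (f n))\<^sup>2)" for n
      by (rule resolvent[OF summ_\<zeta> summ_f s(1)]) (simp only: f_def)
    have \<zeta>_le: "cmod (\<zeta> n) \<le> K\<^sub>1 * (growth s)\<^sup>2 * M" for n
    proof -
      have "(\<Sum>n. (cmod (f n))\<^sup>2) = (\<Sum>n<d + l. (cmod (f n))\<^sup>2)"
        by (rule suminf_finite) (auto simp: f_0)
      also have "\<dots> \<le> real (d + l) * M\<^sup>2"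
        using sum_bounded_above[of "{..<d + l}" "\<lambda>n. (cmod (f n))\<^sup>2" "M\<^sup>2"] power_mono[OF f_le]
        by simp
      finally have "K\<^sub>0 * (\<Sum>n. (cmod (f n))\<^sup>2) \<le> K\<^sub>0 * (real (d + l) * M\<^sup>2)"
        using K0 by (intro mult_left_mono) auto
      also have "\<dots> = (K\<^sub>1 * M)\<^sup>2" using K0 by (simp add: K\<^sub>1_def power_mult_distrib)
      finally have "(Re s * cmod s * cmod (\<zeta> n))\<^sup>2 \<le> (K\<^sub>1 * M)\<^sup>2" using res[of n] by linarith
      then have "Re s * cmod s * cmod (\<zeta> n) \<le> K\<^sub>1 * M"
        by (rule power2_le_imp_le) (use K1 M0 in auto)
      \<comment> \<open>Weakening \<open>cmod s\<close> to \<open>Re s\<close> leaves a loss of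
        \<open>1 / (Re s)\<^sup>2\<close>, hence the \<open>2\<close> in the exponent.\<close>
      moreover have "Re s * Re s * cmod (\<zeta> n) \<le> Re s * cmod s * cmod (\<zeta> n)"
        using s(1) by (intro mult_right_mono mult_left_mono complex_Re_le_cmod) auto
      ultimately have "Re s * Re s * cmod (\<zeta> n) \<le> K\<^sub>1 * M" by linarith
      then have "cmod (\<zeta> n) \<le> K\<^sub>1 * M * (1 / Re s)\<^sup>2"
        using s(1) by (simp add: field_simps power2_eq_square)
      also have "\<dots> \<le> K\<^sub>1 * M * (growth s)\<^sup>2"
        using K1 M0 s(1) growth(3) by (intro mult_left_mono power_mono) auto
      finally show ?thesis by (simp add: mult_ac)
    qed
    have b: "b s \<ge> 1"
      unfolding b_def using K2 growth(2) mult_mono[of 1 "1 + K\<^sub>2" 1 "growth s ^ m"]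
      by (simp add: one_le_power)
    have goal: "(2 * b s) ^ l * (K\<^sub>1 * (growth s)\<^sup>2 * M)
        = (2 * (1 + K\<^sub>2)) ^ l * K\<^sub>1 * growth s ^ (m * l + 2) * M"
    proof -
      have "growth s ^ (m * l + 2) = (growth s ^ m) ^ l * (growth s)\<^sup>2"
        by (simp only: power_add power_mult)
      then show ?thesis by (simp only: b_def power_mult_distrib mult_ac)
    qed
    have nonneg: "K\<^sub>1 * (growth s)\<^sup>2 * M \<ge> 0" using K1 M0 by simp
    show "cmod (vec_index \<Sigma> c) \<le> (2 * (1 + K\<^sub>2)) ^ l * K\<^sub>1 * growth s ^ (m * l + 2) * M"
    \<comment> \<open>For \<open>c < d\<close> the entry is the grid value \<open>\<zeta> c\<close>
      itself, and \<open>(2 * b s) ^ l \<ge> 1\<close> brings the bound to the common form.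
      Otherwise it is a coefficient of the exponential sum formed by \<zeta> from index
      \<open>d\<close> on.\<close>
    proof (cases "c < d")
      case True
      have "\<zeta> c = (\<Sum>k\<in>{c}. vec_index \<Sigma> k * ansatz d \<kappa> s k c)"
        unfolding \<zeta>_def using c True by (intro sum.mono_neutral_right) (auto simp: ansatz_def)
      then have "cmod (vec_index \<Sigma> c) = cmod (\<zeta> c)" using True by (simp add: ansatz_def)
      also have "\<dots> \<le> 1 * (K\<^sub>1 * (growth s)\<^sup>2 * M)" using \<zeta>_le by simp
      also have "\<dots> \<le> (2 * b s) ^ l * (K\<^sub>1 * (growth s)\<^sup>2 * M)"
        using b nonneg by (intro mult_right_mono one_le_power) auto
      finally show ?thesis unfolding goal .
    next
      case False
      define \<sigma> where "\<sigma> j = vec_index \<Sigma> (d + j)" for j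
      have tail: "(\<Sum>k<l. \<sigma> k * \<kappa> k s ^ n) = \<zeta> (n + d)" for n
      proof -
        have "\<zeta> (n + d) = (\<Sum>c\<in>{d..<d + l}. vec_index \<Sigma> c * ansatz d \<kappa> s c (n + d))"
          unfolding \<zeta>_def by (intro sum.mono_neutral_right) (auto simp: ansatz_def)
        also have "\<dots> = (\<Sum>k<l. \<sigma> k * \<kappa> k s ^ n)"
          by (rule sum.reindex_bij_witness[of _ "\<lambda>k. d + k" "\<lambda>c. c - d"])
            (auto simp: ansatz_def \<sigma>_def)
        finally show ?thesis by simp
      qed
      have "cmod (\<sigma> (c - d)) \<le> (2 * b s) ^ l * (K\<^sub>1 * (growth s)\<^sup>2 * M)"
      proof (rule exponential_sum_coefficient_bound[where z = "\<lambda>k. \<kappa> k s"])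
        show "c - d < l" using c False by auto
        show "cmod (\<kappa> i s) \<le> 1" if "i < l" for i using root(2)[OF that] by simp
        show "cmod (\<Sum>k<l. \<sigma> k * \<kappa> k s ^ n) \<le> K\<^sub>1 * (growth s)\<^sup>2 * M" for n
          unfolding tail by (rule \<zeta>_le)
        show "b s \<ge> 1" by (rule b)
        fix i assume i: "i < l" "i \<noteq> c - d"
        have "1 \<le> K\<^sub>2 * growth s ^ m * cmod (\<kappa> (c - d) s - \<kappa> i s)"
          using c False i by (intro sep s) auto
        also have "\<dots> \<le> b s * cmod (\<kappa> (c - d) s - \<kappa> i s)"
          unfolding b_def using growth(2) by (intro mult_right_mono) auto
        finally show "1 \<le> b s * cmod (\<kappa> (c - d) s - \<kappa> i s)" .
      qed
      then show ?thesis unfolding goal using False by (simp add: \<sigma>_def)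
    qed
  qed
qed

section \<open>Behaviour near a nonsingular origin\<close>

text \<open>A perturbation argument: \<open>v\<close> is the inverse of \<open>A0\<close> applied to
  \<open>A s v - (A s - A0) v\<close>, and near the limit the second term accounts for at most half
  of the maximum of \<open>v\<close>.\<close>

lemma mult_vec_bound_near_nonsingular:
  fixes A :: "'s \<Rightarrow> complex mat"
  assumes A: "\<And>s. A s \<in> carrier_mat n n" and A0: "A0 \<in> carrier_mat n n" and det: "Determinant.det A0 \<noteq> 0"
    and lim: "\<And>i j. i < n \<Longrightarrow> j < n \<Longrightarrow> ((\<lambda>s. A s $$ (i, j)) \<longlongrightarrow> A0 $$ (i, j)) F"
  obtains K where "K > 0"
    and "\<forall>\<^sub>F s in F. \<forall>v\<in>carrier_vec n. \<forall>M. (\<forall>i<n. cmod (vec_index (A s *\<^sub>v v) i) \<le> M) \<longrightarrow>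
      (\<forall>i<n. cmod (vec_index v i) \<le> K * M)"
proof -
  \<comment> \<open>The entries of the inverse of \<open>A0\<close>, by the adjugate
    formula.\<close>
  define B where "B i j = adj_mat A0 $$ (i, j) / Determinant.det A0" for i j
  note adj = adj_mat[OF A0]
  have inv: "(\<Sum>j<n. B i j * (\<Sum>k<n. A0 $$ (j, k) * vec_index v k)) = vec_index v i"
    if v: "v \<in> carrier_vec n" and i: "i < n" for v i
  proof -
    have "vec_index (adj_mat A0 *\<^sub>v (A0 *\<^sub>v v)) i
        = vec_index ((Determinant.det A0 \<cdot>\<^sub>m 1\<^sub>m n) *\<^sub>v v) i"
      using assoc_mult_mat_vec[OF adj(1) A0 v] unfolding adj(3) by simp
    also have "\<dots> = Determinant.det A0 * vec_index v i"
      using v i by (simp add: row_smult smult_scalar_prod_distrib[of _ n])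
    finally have "vec_index (adj_mat A0 *\<^sub>v (A0 *\<^sub>v v)) i = Determinant.det A0 * vec_index v i" .
    moreover have "vec_index (adj_mat A0 *\<^sub>v (A0 *\<^sub>v v)) i
        = (\<Sum>j<n. adj_mat A0 $$ (i, j) * (\<Sum>k<n. A0 $$ (j, k) * vec_index v k))"
      using adj(1) A0 v i by (simp add: scalar_prod_def lessThan_atLeast0)
    ultimately show ?thesis
      using det by (simp add: B_def field_simps flip: sum_divide_distrib)
  qed
  define b where "b = 1 + (\<Sum>i<n. \<Sum>j<n. cmod (B i j))"
  have b1: "b \<ge> 1" unfolding b_def by (simp add: sum_nonneg)
  have b: "cmod (B i j) \<le> b" if "i < n" "j < n" for i j
  proof -
    have "cmod (B i j) \<le> (\<Sum>j<n. cmod (B i j))" using that by (intro member_le_sum) auto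
    also have "\<dots> \<le> (\<Sum>i<n. \<Sum>j<n. cmod (B i j))"
      using that by (intro member_le_sum[where f = "\<lambda>i. \<Sum>j<n. cmod (B i j)"]) (auto intro: sum_nonneg)
    finally show ?thesis by (simp add: b_def)
  qed
  \<comment> \<open>Chosen so that the perturbation term is at most half of \<open>V\<close>; the
    \<open>+ 1\<close> keeps the denominator positive for \<open>n = 0\<close>.\<close>
  define e where "e = 1 / (2 * b * (real n + 1)\<^sup>2)"
  have e: "e > 0" using b1 by (simp add: e_def)
  have small: "real n * (b * (real n * e)) \<le> 1 / 2"
  proof -
    have "(real n)\<^sup>2 \<le> (real n + 1)\<^sup>2" by (intro power_mono) auto
    then show ?thesis using b1 by (simp add: e_def power2_eq_square divide_simps)
  qed
  show ?thesis
  proof (rule that[of "2 * (real n + 1) * b"])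
    show "2 * (real n + 1) * b > 0" using b1 by simp
    have "\<forall>\<^sub>F s in F. \<forall>i\<in>{..<n}. \<forall>j\<in>{..<n}. dist (A s $$ (i, j)) (A0 $$ (i, j)) < e"
      using lim e by (intro eventually_ball_finite ballI) (auto dest: tendstoD)
    then show "\<forall>\<^sub>F s in F. \<forall>v\<in>carrier_vec n. \<forall>M. (\<forall>i<n. cmod (vec_index (A s *\<^sub>v v) i) \<le> M) \<longrightarrow>
      (\<forall>i<n. cmod (vec_index v i) \<le> 2 * (real n + 1) * b * M)"
    proof (eventually_elim, intro ballI allI impI)
      fix s v M i
      assume close: "\<forall>i\<in>{..<n}. \<forall>j\<in>{..<n}. dist (A s $$ (i, j)) (A0 $$ (i, j)) < e"
        and v: "v \<in> carrier_vec n" and M: "\<forall>i<n. cmod (vec_index (A s *\<^sub>v v) i) \<le> M" and i: "i < n"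
      define V where "V = Max ((\<lambda>i. cmod (vec_index v i)) ` {..<n})"
      have V: "cmod (vec_index v k) \<le> V" if "k < n" for k
        unfolding V_def using that by (intro Max_ge) auto
      have V0: "V \<ge> 0" and M0: "M \<ge> 0" using V[OF i] M i norm_ge_zero order_trans by blast+
      have Av: "cmod (\<Sum>k<n. A0 $$ (j, k) * vec_index v k) \<le> M + real n * e * V" if j: "j < n" for j
      proof -
        have "(\<Sum>k<n. A0 $$ (j, k) * vec_index v k)
            = vec_index (A s *\<^sub>v v) j - (\<Sum>k<n. (A s $$ (j, k) - A0 $$ (j, k)) * vec_index v k)"
          using A[of s] v j by (simp add: scalar_prod_def lessThan_atLeast0 sum_subtractf algebra_simps)
        also have "cmod \<dots> \<le> M + (\<Sum>k<n. e * V)"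
        proof (rule norm_triangle_le_diff, rule add_mono)
          show "cmod (vec_index (A s *\<^sub>v v) j) \<le> M" using M j by blast
          show "cmod (\<Sum>k<n. (A s $$ (j, k) - A0 $$ (j, k)) * vec_index v k) \<le> (\<Sum>k<n. e * V)"
            unfolding dist_norm using close j V e
            by (intro sum_norm_le) (auto simp: norm_mult dist_norm less_imp_le intro!: mult_mono)
        qed
        finally show ?thesis by (simp add: mult.assoc)
      qed
      have le: "cmod (vec_index v i) \<le> real n * (b * (M + real n * e * V))" if i: "i < n" for i
      proof -
        have "cmod (vec_index v i) \<le> (\<Sum>j<n. b * (M + real n * e * V))"
          unfolding inv[OF v i, symmetric]
          using b[OF i] Av b1 by (intro sum_norm_le) (auto simp: norm_mult intro!: mult_mono)
        then show ?thesis by simp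
      qed
      have "V \<in> (\<lambda>i. cmod (vec_index v i)) ` {..<n}"
        unfolding V_def using i by (intro Max_in) auto
      then have "V \<le> real n * (b * (M + real n * e * V))" using le by auto
      also have "\<dots> = real n * b * M + real n * (b * (real n * e)) * V" by (simp add: algebra_simps)
      also have "\<dots> \<le> real n * b * M + 1 / 2 * V" using small V0 by (intro add_left_mono mult_right_mono)
      finally have "V \<le> 2 * (real n * b * M)" by simp
      also have "\<dots> \<le> 2 * (real n + 1) * b * M" using b1 M0 by (simp add: algebra_simps)
      finally show "cmod (vec_index v i) \<le> 2 * (real n + 1) * b * M" using V[OF i] by linarith
    qed
  qed
qed

lemma continuous_on_determinant_matrix:
  assumes "\<And>j. j < l \<Longrightarrow> continuous_on S (\<kappa> j)" "n < d + l" "c < d + l"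
  shows "continuous_on S (\<lambda>s. determinant_matrix l d Q \<kappa> s $$ (n, c))"
proof -
  have "continuous_on S (\<lambda>s. ansatz d \<kappa> s c m)" for m
    using assms by (cases "c < d"; cases "m < d") (auto simp: ansatz_def intro!: continuous_intros)
  then show ?thesis
    using assms(2,3) by (simp add: determinant_matrix_def apply_op_def) (intro continuous_intros)
qed

text \<open>The origin is a boundary point of the strip; continuity of the roots up to the imaginary
  axis makes the matrix at 0 the limit from inside.\<close>

lemma determinant_matrix_nonsingular_at_0:
  assumes r: "r > 0" and adm: "admissible_roots l r \<kappa>"
    and det: "Determinant.det (determinant_matrix l d Q \<kappa> 0) \<noteq> 0"
  obtains K \<rho> where "K > 0" "\<rho> > 0"
    and "\<And>s \<Sigma> M c. 0 < Re s \<Longrightarrow> cmod s \<le> \<rho> \<Longrightarrow> \<Sigma> \<in> carrier_vec (d + l) \<Longrightarrow>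
      (\<And>n. n < d + l \<Longrightarrow> cmod (vec_index (determinant_matrix l d Q \<kappa> s *\<^sub>v \<Sigma>) n) \<le> M) \<Longrightarrow>
      c < d + l \<Longrightarrow> cmod (vec_index \<Sigma> c) \<le> K * M"
proof -
  let ?S = "{s. 0 \<le> Re s \<and> Re s < r}" and ?C = "determinant_matrix l d Q \<kappa>"
  have carrier: "?C s \<in> carrier_mat (d + l) (d + l)" for s by (simp add: determinant_matrix_def)
  have "((\<lambda>s. ?C s $$ (n, c)) \<longlongrightarrow> ?C 0 $$ (n, c)) (at 0 within ?S)" if "n < d + l" "c < d + l" for n c
  proof -
    have "continuous_on ?S (\<lambda>s. ?C s $$ (n, c))"
      using adm that unfolding admissible_roots_def by (intro continuous_on_determinant_matrix) auto
    then show ?thesis unfolding continuous_on_def using r by auto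
  qed
  from mult_vec_bound_near_nonsingular[OF carrier carrier det this]
  obtain K where K: "K > 0" and ev: "\<forall>\<^sub>F s in at 0 within ?S. \<forall>v\<in>carrier_vec (d + l). \<forall>M.
      (\<forall>i<d + l. cmod (vec_index (?C s *\<^sub>v v) i) \<le> M) \<longrightarrow> (\<forall>i<d + l. cmod (vec_index v i) \<le> K * M)"
    by blast
  from ev obtain e where e: "e > 0" and bound: "\<And>s v M. s \<in> ?S \<Longrightarrow> s \<noteq> 0 \<Longrightarrow> dist s 0 < e \<Longrightarrow> v \<in> carrier_vec (d + l) \<Longrightarrow>
      (\<forall>i<d + l. cmod (vec_index (?C s *\<^sub>v v) i) \<le> M) \<Longrightarrow> (\<forall>i<d + l. cmod (vec_index v i) \<le> K * M)"
    unfolding eventually_at by meson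
  show ?thesis
  proof (rule that[OF K, of "min (e / 2) (r / 2)"])
    show "min (e / 2) (r / 2) > 0" using e r by simp
    fix s \<Sigma> M c
    assume s: "0 < Re s" "cmod s \<le> min (e / 2) (r / 2)" and \<Sigma>: "\<Sigma> \<in> carrier_vec (d + l)"
      and M: "\<And>n. n < d + l \<Longrightarrow> cmod (vec_index (?C s *\<^sub>v \<Sigma>) n) \<le> M" and c: "c < d + l"
    have "s \<noteq> 0" "Re s < r" "dist s 0 < e" using s r e complex_Re_le_cmod[of s] by (auto simp: dist_norm)
    then show "cmod (vec_index \<Sigma> c) \<le> K * M" using bound[of s \<Sigma> M] s(1) \<Sigma> M c by auto
  qed
qed

section \<open>Laplace transforms of time derivatives\<close>

text \<open>A nonzero limit would keep the modulus of \<open>G\<close> above a positive constant on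
  a half-line, which has infinite measure.\<close>

lemma limit_at_top_of_integrable:
  fixes G :: "real \<Rightarrow> complex"
  assumes int: "set_integrable lborel {0..} G" and lim: "(G \<longlongrightarrow> I) at_top"
  shows "I = 0"
proof (rule ccontr)
  assume "I \<noteq> 0"
  define e where "e = cmod I / 2"
  have e: "e > 0" using \<open>I \<noteq> 0\<close> by (simp add: e_def)
  have "\<forall>\<^sub>F t in at_top. e < cmod (G t)"
    using order_tendstoD(1)[OF tendsto_norm[OF lim], of e] e by (simp add: e_def)
  then obtain N where N: "\<And>t. t \<ge> N \<Longrightarrow> e < cmod (G t)"
    unfolding eventually_at_top_linorder by blast
  define A where "A = {max N 0..}"
  have "integrable lborel (\<lambda>t. indicator A t * e)"
  proof (rule Bochner_Integration.integrable_bound)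
    show "integrable lborel (\<lambda>t. indicator {0..} t *\<^sub>R G t)" using int unfolding set_integrable_def .
    show "(\<lambda>t. indicator A t * e) \<in> borel_measurable lborel" unfolding A_def by simp
    show "AE t in lborel. norm (indicator A t * e) \<le> norm (indicator {0..} t *\<^sub>R G t)"
      using N e by (intro AE_I2) (auto simp: A_def indicator_def less_imp_le)
  qed
  then have "integrable lborel (indicator A :: real \<Rightarrow> real)"
    using e by simp
  then have "emeasure lborel A < \<infinity>" by (simp add: integrable_indicator_iff)
  then obtain c where c: "c \<ge> 0" "emeasure lborel A = ennreal c"
    by (cases "emeasure lborel A") auto
  have "ennreal (c + 1) = emeasure lborel {max N 0..max N 0 + (c + 1)}" using c by simp
  also have "\<dots> \<le> emeasure lborel A" unfolding A_def by (intro emeasure_mono) auto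
  finally show False using c by simp
qed

text \<open>The kernel is \<open>exp (- Re s * t)\<close> times a continuous factor of modulus
  one.\<close>

lemma set_integrable_laplace:
  assumes "set_integrable lborel {0..} (\<lambda>t. exp (- Re s * t) * f t)"
  shows "set_integrable lborel {0..} (\<lambda>t. exp (- s * complex_of_real t) * complex_of_real (f t))"
proof -
  let ?g = "\<lambda>t. indicator {0..} t *\<^sub>R (exp (- Re s * t) * f t)"
  have g: "integrable lborel ?g" using assms unfolding set_integrable_def .
  have eq: "indicator {0..} t *\<^sub>R (exp (- s * complex_of_real t) * complex_of_real (f t))
      = exp (- (\<i> * of_real (Im s)) * of_real t) * complex_of_real (?g t)" for t
  proof -
    have "- s * complex_of_real t = - (\<i> * of_real (Im s)) * of_real t + of_real (- Re s * t)"
      by (simp add: complex_eq_iff)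
    then have "exp (- s * complex_of_real t)
        = exp (- (\<i> * of_real (Im s)) * of_real t) * complex_of_real (exp (- Re s * t))"
      by (simp only: exp_add exp_of_real)
    then show ?thesis by (simp add: scaleR_conv_of_real mult_ac)
  qed
  have meas: "?g \<in> borel_measurable lborel" using g by (rule borel_measurable_integrable)
  show ?thesis
    unfolding set_integrable_def eq
  proof (rule Bochner_Integration.integrable_bound[OF g])
    have "(\<lambda>t. complex_of_real (?g t)) \<in> borel_measurable lborel"
      by (rule measurable_compose[OF meas]) (intro borel_measurable_continuous_onI continuous_intros)
    moreover have "(\<lambda>t::real. exp (- (\<i> * of_real (Im s)) * complex_of_real t)) \<in> borel_measurable lborel"
      unfolding measurable_lborel2 by (intro borel_measurable_continuous_onI continuous_intros)
    ultimately show "(\<lambda>t. exp (- (\<i> * of_real (Im s)) * of_real t) * complex_of_real (?g t)) \<in> borel_measurable lborel"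
      by (rule borel_measurable_times[rotated])
    show "AE t in lborel. norm (exp (- (\<i> * of_real (Im s)) * of_real t) * complex_of_real (?g t)) \<le> norm (?g t)"
      by (simp add: norm_mult)
  qed
qed

text \<open>Integration by parts. The boundary term at 0 vanishes by \<open>init\<close>; the one at
  infinity vanishes by integrability, so no pointwise decay of \<open>f\<close> has to be
  assumed.\<close>

lemma laplace_derivative:
  assumes deriv: "\<And>t. t \<ge> 0 \<Longrightarrow> (f has_real_derivative f' t) (at t within {0..})"
    and cont: "continuous_on {0..} f'" and init: "f 0 = 0"
    and int: "set_integrable lborel {0..} (\<lambda>t. exp (- Re s * t) * f t)"
    and int': "set_integrable lborel {0..} (\<lambda>t. exp (- Re s * t) * f' t)"
  shows "laplace f' s = s * laplace f s"
proof -
  let ?E = "\<lambda>t. exp (- s * complex_of_real t)"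
  define G where "G t = ?E t * of_real (f t)" for t
  define g where "g t = ?E t * of_real (f' t) - s * (?E t * of_real (f t))" for t
  note I = set_integrable_laplace[OF int] and I' = set_integrable_laplace[OF int']
  have intg: "set_integrable lborel {0..} g"
    unfolding g_def by (intro set_integral_diff(1) set_integrable_mult_right I I')
  have contf: "continuous_on {0..} f"
    using deriv by (auto simp: continuous_on_eq_continuous_within intro: DERIV_continuous)
  have FTC: "integral\<^sup>L lborel (\<lambda>t. indicator {0..y} t *\<^sub>R g t) = G y" if y: "y \<ge> 0" for y
  proof -
    have "integral\<^sup>L lborel (\<lambda>t. indicator {0..y} t *\<^sub>R g t) = G y - G 0"
    proof (rule integral_FTC_atLeastAtMost[OF y])
      fix t assume t: "0 \<le> t" "t \<le> y"
      have "(f has_vector_derivative f' t) (at t within {0..y})"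
        using deriv[OF t(1)] has_real_derivative_iff_has_vector_derivative
        by (auto intro: has_vector_derivative_within_subset)
      then have 1: "((\<lambda>t. complex_of_real (f t)) has_vector_derivative of_real (f' t)) (at t within {0..y})"
        by (intro bounded_linear.has_vector_derivative[OF bounded_linear_of_real])
      have "((\<lambda>z. exp (- s * z)) has_field_derivative (- s * ?E t)) (at (of_real t))"
        by (auto intro!: derivative_eq_intros)
      then have "(?E has_vector_derivative (- s * ?E t)) (at t within {0..y})"
        by (rule has_vector_derivative_real_field)
      from has_vector_derivative_mult[OF this 1]
      show "(G has_vector_derivative g t) (at t within {0..y})"
        unfolding G_def g_def by (simp add: algebra_simps)
    next
      have "continuous_on {0..y} f" "continuous_on {0..y} f'"
        using contf cont by (auto intro: continuous_on_subset)
      then show "continuous_on {0..y} g" unfolding g_def by (intro continuous_intros)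
    qed
    then show ?thesis using init by (simp add: G_def)
  qed
  \<comment> \<open>The truncated integrals equal \<open>G y\<close> and converge to the full
    integral. Thus \<open>G\<close> has a limit, which is 0 as \<open>G\<close> is
    integrable.\<close>
  have "((\<lambda>y. integral\<^sup>L lborel (\<lambda>t. indicator {..y} t *\<^sub>R (indicator {0..} t *\<^sub>R g t)))
      \<longlongrightarrow> (LINT t:{0..}|lborel. g t)) at_top"
    unfolding set_lebesgue_integral_def
    by (rule tendsto_integral_at_top) (use intg in \<open>auto simp: set_integrable_def\<close>)
  moreover have "\<forall>\<^sub>F y in at_top. integral\<^sup>L lborel (\<lambda>t. indicator {..y} t *\<^sub>R (indicator {0..} t *\<^sub>R g t)) = G y"
    using eventually_ge_at_top[of 0]
  proof eventually_elim
    case (elim y)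
    have "indicator {..y} t *\<^sub>R (indicator {0..} t *\<^sub>R g t) = indicator {0..y} t *\<^sub>R g t" for t
      by (auto simp: indicator_def)
    then show ?case by (simp only: FTC[OF elim])
  qed
  ultimately have "(G \<longlongrightarrow> (LINT t:{0..}|lborel. g t)) at_top"
    by (rule Lim_transform_eventually)
  moreover have "set_integrable lborel {0..} G" unfolding G_def by (rule I)
  ultimately have "(LINT t:{0..}|lborel. g t) = 0" using limit_at_top_of_integrable by blast
  moreover have "(LINT t:{0..}|lborel. g t) = laplace f' s - s * laplace f s"
  proof -
    have "set_integrable lborel {0..} (\<lambda>t. s * (?E t * of_real (f t)))"
      by (intro set_integrable_mult_right I)
    then show ?thesis
      unfolding g_def laplace_def using I' by (subst set_integral_diff) simp_all
  qed
  ultimately show ?thesis by simp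
qed

lemma laplace_mult: "laplace (\<lambda>t. c * f t) s = of_real c * laplace f s"
  unfolding laplace_def set_integral_mult_right[symmetric] by (simp add: mult_ac)

section \<open>Time derivatives of the solution at the boundary\<close>

text \<open>No point of the closed half-line is isolated from the right, so one-sided derivatives
  are unique at 0 as well.\<close>

lemma has_real_derivative_unique_atLeast:
  assumes f: "(f has_real_derivative D) (at x within {0..})" and g: "(g has_real_derivative E) (at x within {0..})"
    and x: "x \<ge> 0" and eq: "\<And>y. y \<ge> 0 \<Longrightarrow> f y = g y"
  shows "D = E"
proof (rule vector_derivative_unique_within)
  have "at_right x \<le> at x within {0..}" using x by (intro at_le) auto
  then show "at x within {0..} \<noteq> bot" by (metis bot.extremum_uniqueI trivial_limit_at_right_real)
  show "(f has_vector_derivative D) (at x within {0..})"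
    using f by (simp add: has_real_derivative_iff_has_vector_derivative)
  have "(f has_real_derivative E) (at x within {0..})"
    using x eq by (intro has_field_derivative_transform_within[OF g, of 1]) auto
  then show "(f has_vector_derivative E) (at x within {0..})"
    by (simp add: has_real_derivative_iff_has_vector_derivative)
qed

text \<open>The wave equation is given for \<open>U 0 0\<close> only; uniqueness of derivatives
  propagates it, first through all orders in \<open>t\<close>, then through all orders in
  \<open>x\<close>.\<close>

lemma smooth_wave_solution_time_derivative:
  assumes "smooth_wave_solution U" "x \<ge> 0" "t \<ge> 0"
  shows "U i (j + 2) x t = U (i + 2) j x t"
proof -
  have dx: "((\<lambda>y. U i j y t) has_real_derivative U (Suc i) j x t) (at x within {0..})"
    and dt: "((\<lambda>\<tau>. U i j x \<tau>) has_real_derivative U i (Suc j) x t) (at t within {0..})"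
    if "x \<ge> 0" "t \<ge> 0" for i j x t
    using assms(1) that unfolding smooth_wave_solution_def by auto
  have U02: "U 0 2 x t = U 2 0 x t" if "x \<ge> 0" "t \<ge> 0" for x t
    using assms(1) that unfolding smooth_wave_solution_def by auto
  have wave: "U 0 (j + 2) x t = U 2 j x t" if "x \<ge> 0" "t \<ge> 0" for j x t
    using that
  proof (induction j arbitrary: t)
    case 0
    then show ?case using U02 by (simp add: numeral_2_eq_2)
  next
    case (Suc j)
    show ?case
      using has_real_derivative_unique_atLeast[OF dt[OF Suc.prems, of 0 "j + 2"] dt[OF Suc.prems, of 2 j]] Suc
      by simp
  qed
  have "U i (j + 2) x t = U (i + 2) j x t" if "x \<ge> 0" "t \<ge> 0" for i x
    using that
  proof (induction i arbitrary: x)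
    case 0
    then show ?case using wave by (simp add: numeral_2_eq_2)
  next
    case (Suc i)
    show ?case
      using has_real_derivative_unique_atLeast[OF dx[OF Suc.prems, of i "j + 2"] dx[OF Suc.prems, of "i + 2" j]] Suc
      by simp
  qed
  then show ?thesis using assms(2,3) by blast
qed

text \<open>Two time derivatives are traded for two space derivatives, which keeps
  \<open>i + j\<close>, until at most one time derivative is left and the initial data
  decide.\<close>

lemma compatible_data_time_derivative:
  assumes U: "smooth_wave_solution U" and comp: "compatible_data N U" and "i + j < N"
  shows "U i j 0 0 = 0"
  using assms(3)
proof (induction j arbitrary: i rule: less_induct)
  case (less j)
  show ?case
  proof (cases "j < 2")
    case True
    then show ?thesis using comp less.prems by (auto simp: compatible_data_def less_2_cases_iff)
  next
    case False
    then obtain j' where j': "j = j' + 2" by (metis add.commute le_Suc_ex not_less)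
    then have "U i j 0 0 = U (i + 2) j' 0 0" using smooth_wave_solution_time_derivative[OF U] by simp
    also have "\<dots> = 0" using j' less.prems by (intro less.IH) auto
    finally show ?thesis .
  qed
qed

lemma laplace_time_derivative:
  assumes U: "smooth_wave_solution U" and comp: "compatible_data (i + \<alpha>) U"
    and int: "\<And>j. j \<le> \<alpha> \<Longrightarrow> set_integrable lborel {0..} (\<lambda>t. exp (- Re s * t) * U i j 0 t)"
    and "j \<le> \<alpha>"
  shows "laplace (U i j 0) s = s ^ j * laplace (U i 0 0) s"
  using \<open>j \<le> \<alpha>\<close>
proof (induction j)
  case 0
  show ?case by simp
next
  case (Suc j)
  have "laplace (U i (Suc j) 0) s = s * laplace (U i j 0) s"
  proof (rule laplace_derivative)
    show "(U i j 0 has_real_derivative U i (Suc j) 0 t) (at t within {0..})" if "t \<ge> 0" for t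
      using U that unfolding smooth_wave_solution_def by auto
    have "continuous_on ({0..} \<times> {0..}) (\<lambda>(x, t). U i (Suc j) x t)"
      using U unfolding smooth_wave_solution_def by blast
    then have "continuous_on {0..} ((\<lambda>(x, t). U i (Suc j) x t) \<circ> (\<lambda>t. (0, t)))"
      by (intro continuous_on_compose continuous_intros) (auto elim: continuous_on_subset)
    then show "continuous_on {0..} (U i (Suc j) 0)" by (simp add: o_def)
    show "U i j 0 0 = 0" using compatible_data_time_derivative[OF U comp] Suc.prems by simp
  qed (use int Suc.prems in auto)
  then show ?case using Suc by simp
qed

lemma laplace_boundary_truncation:
  assumes "smooth_wave_solution U" "compatible_data (p + 2 + \<alpha>) U"
    and "\<And>j. j \<le> \<alpha> \<Longrightarrow> set_integrable lborel {0..} (\<lambda>t. exp (- Re s * t) * U (p + 2) j 0 t)"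
  shows "laplace (boundary_truncation p k a U \<alpha> i) s = s ^ \<alpha> * laplace (boundary_truncation p k a U 0 i) s"
proof -
  have eq: "boundary_truncation p k a U j i = (\<lambda>t. (if i \<le> k then a i else 0) * U (p + 2) j 0 t)" for j
    by (auto simp: boundary_truncation_def)
  show ?thesis
    unfolding eq laplace_mult using laplace_time_derivative[OF assms order_refl] by simp
qed

lemma cmod_le_max_norm: "i < dim_vec v \<Longrightarrow> cmod (vec_index v i) \<le> max_norm v"
  unfolding max_norm_def by (intro Max_ge) auto

lemma max_norm_attained:
  assumes "dim_vec v > 0"
  obtains i where "i < dim_vec v" "max_norm v = cmod (vec_index v i)"
proof -
  have "max_norm v \<in> (\<lambda>i. cmod (vec_index v i)) ` {..<dim_vec v}"
    unfolding max_norm_def using assms by (intro Max_in) auto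
  with that show ?thesis by auto
qed

section \<open>The error bounds\<close>

text \<open>The exponents, \<open>K\<close> and \<open>\<delta>\<^sub>0\<close> are chosen before
  \<open>\<delta>\<close>, \<open>\<eta>\<close>, \<open>h\<close>, \<open>\<xi>\<close> and
  \<open>U\<close>, so the constant depends on none of these. The variable \<open>s'\<close> is the
  scaled one and \<open>s\<close> the unscaled one. The power of \<open>h\<close> near the origin is
  \<open>powi\<close> because \<open>w\<close> may exceed \<open>p + 2\<close>.\<close>

theorem lemma4:
  fixes l d p k :: nat
    and Q :: "nat \<Rightarrow> nat \<Rightarrow> real"
    and a :: "nat \<Rightarrow> real"
    and \<kappa> :: "nat \<Rightarrow> complex \<Rightarrow> complex"
    and r :: real
  defines "C \<equiv> determinant_matrix l d Q \<kappa>"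
    and "T \<equiv> boundary_truncation p k a"
  assumes "l \<ge> 1"
    and "half_line_scheme l d Q"
    and "energy_stable Q"
    and "r > 0"
    and "admissible_roots l r \<kappa>"
    and "k < d + l"
  shows "\<exists>(w::nat) (\<alpha>::nat) (K::real) (\<delta>\<^sub>0::real). K > 0 \<and> \<delta>\<^sub>0 > 0 \<and>
    (Determinant.det (C 0) \<noteq> 0 \<longrightarrow> w = 0) \<and>
    (\<forall>\<delta> \<eta> h \<xi> :: real. \<forall>U. \<forall>\<Sigma> \<in> carrier_vec (d + l). \<forall>s :: complex. \<forall>s' :: complex.
       0 < \<delta> \<and> \<delta> \<le> \<delta>\<^sub>0 \<and> 0 < \<eta> \<and> 0 < h \<and> \<eta> * h \<le> \<delta>\<^sub>0 \<and>
       s' = \<i> * of_real \<xi> + of_real (\<eta> * h) \<and> s = s' / of_real h \<and>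
       smooth_wave_solution U \<and> compatible_data (p + 2 + \<alpha>) U \<and>
       (\<forall>j\<le>\<alpha>. set_integrable lborel {0..} (\<lambda>t. exp (- \<eta> * t) * U (p + 2) j 0 t)) \<and>
       C s' *\<^sub>v \<Sigma> = of_real (h ^ (p + 2)) \<cdot>\<^sub>v laplace_vec (d + l) (T U 0) s
       \<longrightarrow>
       (cmod s' \<le> \<delta> \<longrightarrow>
          (\<forall>i < d + l. cmod (vec_index \<Sigma> i) \<le>
             h powi (int (p + 2) - int w) * (K / \<eta> ^ w)
               * max_norm (laplace_vec (d + l) (T U 0) s))) \<and>
       (cmod s' > \<delta> \<longrightarrow>
          (\<forall>i < d + l. cmod (vec_index \<Sigma> i) \<le>
             h ^ (p + 2) * (K / (\<eta> * \<delta>) ^ \<alpha>)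
               * max_norm (laplace_vec (d + l) (T U \<alpha>) s))))"
proof -
  have n: "d + l > 0" using assms(3) by simp
  obtain K m where K: "K > 0"
    and strip: "\<And>s \<Sigma> M c. 0 < Re s \<Longrightarrow> Re s \<le> min 1 (r / 2) \<Longrightarrow> \<Sigma> \<in> carrier_vec (d + l) \<Longrightarrow>
      (\<And>n. n < d + l \<Longrightarrow> cmod (vec_index (C s *\<^sub>v \<Sigma>) n) \<le> M) \<Longrightarrow>
      c < d + l \<Longrightarrow> cmod (vec_index \<Sigma> c) \<le> K * growth s ^ m * M"
    unfolding C_def using determinant_matrix_inverse_bound[OF assms(3-7)] by blast
  \<comment> \<open>In the singular case \<open>w\<close> is the strip exponent \<open>m\<close>, as
    \<open>growth s \<le> 2 / Re s\<close> on the unit disc; in the nonsingular case the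
    perturbation bound gives \<open>w = 0\<close>.\<close>
  obtain w K\<^sub>0 \<rho> where w: "Determinant.det (C 0) \<noteq> 0 \<longrightarrow> w = 0" and K0: "K\<^sub>0 > 0" and \<rho>: "\<rho> > 0"
    and origin: "\<And>s \<Sigma> M c. 0 < Re s \<Longrightarrow> Re s \<le> min 1 (r / 2) \<Longrightarrow> cmod s \<le> \<rho> \<Longrightarrow> \<Sigma> \<in> carrier_vec (d + l) \<Longrightarrow>
      (\<And>n. n < d + l \<Longrightarrow> cmod (vec_index (C s *\<^sub>v \<Sigma>) n) \<le> M) \<Longrightarrow>
      c < d + l \<Longrightarrow> cmod (vec_index \<Sigma> c) \<le> K\<^sub>0 / Re s ^ w * M"
  proof (cases "Determinant.det (C 0) = 0")
    case True
    show ?thesis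
    proof (rule that[of m "K * 2 ^ m" 1])
      fix s \<Sigma> M c
      assume s: "0 < Re s" "Re s \<le> min 1 (r / 2)" "cmod s \<le> 1" and \<Sigma>: "\<Sigma> \<in> carrier_vec (d + l)"
        and M: "\<And>n. n < d + l \<Longrightarrow> cmod (vec_index (C s *\<^sub>v \<Sigma>) n) \<le> M" and c: "c < d + l"
      have M0: "M \<ge> 0" using M[OF c] norm_ge_zero order_trans by blast
      have "growth s \<le> 2 / Re s" unfolding growth_def using s by (intro divide_right_mono) auto
      moreover have "growth s \<ge> 0" unfolding growth_def using s by simp
      ultimately have "growth s ^ m \<le> (2 / Re s) ^ m" by (rule power_mono)
      then have "K * growth s ^ m * M \<le> K * (2 / Re s) ^ m * M"
        using K M0 by (intro mult_right_mono mult_left_mono) auto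
      with strip[OF s(1,2) \<Sigma> M c] show "cmod (vec_index \<Sigma> c) \<le> K * 2 ^ m / Re s ^ m * M"
        by (simp add: power_divide)
    qed (use True K in auto)
  next
    case False
    then obtain K' \<rho>' where *: "K' > 0" "\<rho>' > 0"
      and near: "\<And>s \<Sigma> M c. 0 < Re s \<Longrightarrow> cmod s \<le> \<rho>' \<Longrightarrow> \<Sigma> \<in> carrier_vec (d + l) \<Longrightarrow>
        (\<And>n. n < d + l \<Longrightarrow> cmod (vec_index (C s *\<^sub>v \<Sigma>) n) \<le> M) \<Longrightarrow>
        c < d + l \<Longrightarrow> cmod (vec_index \<Sigma> c) \<le> K' * M"
      unfolding C_def using determinant_matrix_nonsingular_at_0[OF assms(6,7), where d = d and Q = Q] by blast
    show ?thesis by (rule that[of 0 K' \<rho>']) (use * near in auto)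
  qed
  define K\<^sub>1 where "K\<^sub>1 = K\<^sub>0 + K * 2 ^ m"
  have K1: "K\<^sub>1 > 0" "K\<^sub>0 \<le> K\<^sub>1" "K * 2 ^ m \<le> K\<^sub>1" using K K0 by (auto simp: K\<^sub>1_def add_pos_pos)
  \<comment> \<open>Since \<open>Re s' = \<eta> * h\<close>, this keeps \<open>s'\<close> in the
    half strip of the inverse bound and the region near the origin inside the disc of radius \<rho>.
    It also gives \<open>\<delta> \<le> 1\<close>.\<close>
  define \<delta>\<^sub>0 where "\<delta>\<^sub>0 = min (min 1 (r / 2)) \<rho>"
  have \<delta>0: "\<delta>\<^sub>0 > 0" using \<rho> assms(6) by (simp add: \<delta>\<^sub>0_def)
  have main: "(cmod s' \<le> \<delta> \<longrightarrow>
          (\<forall>i < d + l. cmod (vec_index \<Sigma> i) \<le>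
             h powi (int (p + 2) - int w) * (K\<^sub>1 / \<eta> ^ w)
               * max_norm (laplace_vec (d + l) (T U 0) s))) \<and>
       (cmod s' > \<delta> \<longrightarrow>
          (\<forall>i < d + l. cmod (vec_index \<Sigma> i) \<le>
             h ^ (p + 2) * (K\<^sub>1 / (\<eta> * \<delta>) ^ m)
               * max_norm (laplace_vec (d + l) (T U m) s)))"
    if \<Sigma>: "\<Sigma> \<in> carrier_vec (d + l)"
      and \<delta>: "0 < \<delta>" "\<delta> \<le> \<delta>\<^sub>0" and \<eta>: "0 < \<eta>" and h: "0 < h" and \<eta>h: "\<eta> * h \<le> \<delta>\<^sub>0"
      and s': "s' = \<i> * of_real \<xi> + of_real (\<eta> * h)" and s: "s = s' / of_real h"
      and U: "smooth_wave_solution U" "compatible_data (p + 2 + m) U"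
      and int: "\<forall>j\<le>m. set_integrable lborel {0..} (\<lambda>t. exp (- \<eta> * t) * U (p + 2) j 0 t)"
      and sys: "C s' *\<^sub>v \<Sigma> = of_real (h ^ (p + 2)) \<cdot>\<^sub>v laplace_vec (d + l) (T U 0) s"
    for \<delta> \<eta> h \<xi> :: real and U \<Sigma> and s s' :: complex
  proof -
    let ?T = "\<lambda>j. laplace_vec (d + l) (T U j) s"
    have Re_s': "Re s' = \<eta> * h" by (simp add: s')
    have Re_s: "Re s = \<eta>" using h by (simp add: s Re_divide_of_real Re_s')
    have pos: "0 < Re s'" using \<eta> h by (simp add: Re_s')
    have small: "Re s' \<le> min 1 (r / 2)" using \<eta>h by (simp add: Re_s' \<delta>\<^sub>0_def)
    have dim: "dim_vec (?T j) = d + l" for j by (simp add: laplace_vec_def)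
    have norm0: "0 \<le> max_norm (?T j)" for j
      using cmod_le_max_norm[of 0 "?T j"] n dim norm_ge_zero order_trans by metis
    define M where "M = h ^ (p + 2) * max_norm (?T 0)"
    have M0: "M \<ge> 0" using h norm0 by (simp add: M_def)
    have rhs: "cmod (vec_index (C s' *\<^sub>v \<Sigma>) i) \<le> M" if "i < d + l" for i
    proof -
      have "vec_index (C s' *\<^sub>v \<Sigma>) i = of_real (h ^ (p + 2)) * vec_index (?T 0) i"
        unfolding sys using that dim by simp
      moreover have "cmod (vec_index (?T 0) i) \<le> max_norm (?T 0)"
        using that dim by (intro cmod_le_max_norm) simp
      ultimately show ?thesis unfolding M_def using h by (simp only: norm_mult norm_of_real) simp
    qed
    have "cmod (vec_index \<Sigma> i) \<le> h powi (int (p + 2) - int w) * (K\<^sub>1 / \<eta> ^ w) * max_norm (?T 0)"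
      if "cmod s' \<le> \<delta>" and i: "i < d + l" for i
    proof -
      have "cmod s' \<le> \<rho>" using that(1) \<delta>(2) by (simp add: \<delta>\<^sub>0_def)
      then have "cmod (vec_index \<Sigma> i) \<le> K\<^sub>0 / Re s' ^ w * M"
        using origin[OF pos small _ \<Sigma> rhs i] by blast
      also have "\<dots> \<le> K\<^sub>1 / Re s' ^ w * M"
        using K1 pos M0 by (intro mult_right_mono divide_right_mono) auto
      also have "\<dots> = h powi (int (p + 2) - int w) * (K\<^sub>1 / \<eta> ^ w) * max_norm (?T 0)"
      proof -
        have "h \<noteq> 0" using h by simp
        then have "h powi (int (p + 2) - int w) = h ^ (p + 2) / h ^ w"
          by (rule power_int_diff[of h "int (p + 2)" "int w", OF disjI1, unfolded power_int_of_nat])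
        then show ?thesis by (simp only: M_def Re_s' power_mult_distrib) (simp add: field_simps)
      qed
      finally show ?thesis .
    qed
    moreover have "cmod (vec_index \<Sigma> i) \<le> h ^ (p + 2) * (K\<^sub>1 / (\<eta> * \<delta>) ^ m) * max_norm (?T m)"
      if far: "cmod s' > \<delta>" and i: "i < d + l" for i
    proof -
      \<comment> \<open>Here \<alpha> is \<open>m\<close>: each power of \<open>cmod s\<close> is
        paid for by one time derivative of the data. The comparison is made at a component attaining
        the maximum.\<close>
      have "max_norm (?T 0) * cmod s ^ m \<le> max_norm (?T m)"
      proof -
        obtain c where c: "c < d + l" "max_norm (?T 0) = cmod (vec_index (?T 0) c)"
          using max_norm_attained[of "?T 0"] n dim by metis
        have "vec_index (?T m) c = s ^ m * vec_index (?T 0) c"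
          unfolding T_def laplace_vec_def using c(1) int Re_s
          by (simp add: laplace_boundary_truncation[OF U])
        then have "max_norm (?T 0) * cmod s ^ m = cmod (vec_index (?T m) c)"
          by (simp add: c(2) norm_mult norm_power)
        also have "\<dots> \<le> max_norm (?T m)" using c(1) dim by (intro cmod_le_max_norm) simp
        finally show ?thesis .
      qed
      then have T: "max_norm (?T 0) * (cmod s' / h) ^ m \<le> max_norm (?T m)"
        using h by (simp add: s norm_divide)
      have "1 + cmod s' \<le> 2 * (cmod s' / \<delta>)"
      proof -
        have "1 \<le> cmod s' / \<delta>" using far \<delta>(1) by simp
        moreover have "cmod s' * \<delta> \<le> cmod s' * 1" using \<delta> by (intro mult_left_mono) (auto simp: \<delta>\<^sub>0_def)
        then have "cmod s' \<le> cmod s' / \<delta>" using \<delta>(1) by (simp add: pos_le_divide_eq)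
        ultimately show ?thesis by simp
      qed
      \<comment> \<open>The \<open>h\<close> in \<open>Re s' = \<eta> * h\<close> turns
        \<open>cmod s'\<close> into the modulus of the unscaled \<open>s\<close>, so the far region
        loses no power of \<open>h\<close>.\<close>
      then have "growth s' \<le> 2 * (cmod s' / \<delta>) / Re s'"
        unfolding growth_def using pos by (intro divide_right_mono) auto
      also have "\<dots> = 2 / (\<eta> * \<delta>) * (cmod s' / h)" by (simp add: Re_s')
      finally have "growth s' ^ m \<le> (2 / (\<eta> * \<delta>) * (cmod s' / h)) ^ m"
        by (rule power_mono) (use pos in \<open>simp add: growth_def\<close>)
      then have "K * growth s' ^ m * M \<le> K * (2 / (\<eta> * \<delta>) * (cmod s' / h)) ^ m * M"
        using K M0 by (intro mult_right_mono mult_left_mono) auto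
      also have "\<dots> = h ^ (p + 2) * (K * 2 ^ m / (\<eta> * \<delta>) ^ m) * (max_norm (?T 0) * (cmod s' / h) ^ m)"
        by (simp only: M_def power_mult_distrib power_divide times_divide_eq_left times_divide_eq_right mult_ac)
      also have "\<dots> \<le> h ^ (p + 2) * (K\<^sub>1 / (\<eta> * \<delta>) ^ m) * max_norm (?T m)"
        using T K1 K h \<eta> \<delta> norm0 by (intro mult_mono mult_left_mono divide_right_mono) auto
      finally show ?thesis using strip[OF pos small \<Sigma> rhs i] by linarith
    qed
    ultimately show ?thesis by blast
  qed
  show ?thesis
    by (rule exI[of _ w], rule exI[of _ m], rule exI[of _ K\<^sub>1], rule exI[of _ \<delta>\<^sub>0],
      intro conjI[OF K1(1)] conjI[OF \<delta>0] conjI[OF w] allI ballI impI, elim conjE, rule main)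
qed

end
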